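(* Enumerating $C_{\mathcal{CRDF},G}[A]$ and enumerating $C_{\mathcal{TRDF},G}[A]$ (given a graph $G=(V,E)$ and $A\subseteq V$) are each at least as hard as Enum Tr, even when $G$ is restricted to split graphs: if either of these enumeration problems restricted to split graphs can be solved in output-polynomial time, then all minimal hitting sets of a hypergraph can be enumerated in output-polynomial time.
   Context: A graph is a split graph if its vertex set can be partitioned into a clique and an independent set. For $f:V\to\{0,1,2\}$, $V_i(f)=\{v: f(v)=i\}$; $f\le g$ is pointwise. A Roman dominating function (Rdf) is an $f:V\to\{0,1,2\}$ such that each $v\in V_0(f)$ has a neighbor in $V_2(f)$. A connected Roman dominating function (cRdf) is an Rdf $f$ with $G[V_1(f)\cup V_2(f)]$ connected; a total Roman dominating function (tRdf) is an Rdf $f$ such that every vertex of $V_1(f)\cup V_2(f)$ has a neighbor in $V_1(f)\cup V_2(f)$. Minimality is with respect to $\le$ within each class. $C_{\mathcal{CRDF},G}[A]$ (resp. $C_{\mathcal{TRDF},G}[A]$) is the set of minimal cRdfs (resp. tRdfs) $f$ on $G$ with $V_2(f)=A$. For a hypergraph $H=(X,S)$ with $S\subseteq 2^X$, a hitting set is $D\subseteq X$ with $D\cap s\ne\emptyset$ for all $s\in S$; Enum Tr is the problem of enumerating all inclusion-minimal hitting sets of a given hypergraph. An enumeration algorithm runs in output-polynomial time if its running time is polynomial in the input size plus the number of outputs. *)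

theory Defs
  imports Main "HOL-Library.FuncSet" "HOL-Computational_Algebra.Polynomial"
begin

section \<open>Graphs and Roman domination\<close>

record 'a ugraph =
  verts :: "'a set"
  edges :: "'a set set"

definition simple_graph :: "'a ugraph \<Rightarrow> bool" where
  "simple_graph G \<longleftrightarrow> finite (verts G) \<and>
     edges G \<subseteq> {{u, v} | u v. u \<in> verts G \<and> v \<in> verts G \<and> u \<noteq> v}"

definition adj :: "'a ugraph \<Rightarrow> 'a \<Rightarrow> 'a \<Rightarrow> bool" where
  "adj G u v \<longleftrightarrow> {u, v} \<in> edges G"

definition clique :: "'a ugraph \<Rightarrow> 'a set \<Rightarrow> bool" where
  "clique G K \<longleftrightarrow> K \<subseteq> verts G \<and> (\<forall>u\<in>K. \<forall>v\<in>K. u \<noteq> v \<longrightarrow> adj G u v)"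

definition independent :: "'a ugraph \<Rightarrow> 'a set \<Rightarrow> bool" where
  "independent G I \<longleftrightarrow> I \<subseteq> verts G \<and> (\<forall>u\<in>I. \<forall>v\<in>I. \<not> adj G u v)"

definition split_graph :: "'a ugraph \<Rightarrow> bool" where
  "split_graph G \<longleftrightarrow>
     (\<exists>K I. K \<union> I = verts G \<and> K \<inter> I = {} \<and> clique G K \<and> independent G I)"

definition induced :: "'a ugraph \<Rightarrow> 'a set \<Rightarrow> 'a ugraph" where
  "induced G U = \<lparr>verts = verts G \<inter> U, edges = {e \<in> edges G. e \<subseteq> U}\<rparr>"

definition connected_graph :: "'a ugraph \<Rightarrow> bool" where
  "connected_graph G \<longleftrightarrow> (\<forall>u\<in>verts G. \<forall>v\<in>verts G. (adj G)\<^sup>*\<^sup>* u v)"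

definition level :: "'a ugraph \<Rightarrow> ('a \<Rightarrow> nat) \<Rightarrow> nat \<Rightarrow> 'a set" where
  "level G f i = {v \<in> verts G. f v = i}"

text \<open>A function on the vertex set is represented by its extensional extension to the whole type,
  so that distinct HOL functions are distinct functions on the vertex set.\<close>

definition rdf :: "'a ugraph \<Rightarrow> ('a \<Rightarrow> nat) \<Rightarrow> bool" where
  "rdf G f \<longleftrightarrow> f \<in> verts G \<rightarrow>\<^sub>E {0, 1, 2} \<and> (\<forall>v\<in>level G f 0. \<exists>u\<in>level G f 2. adj G v u)"

definition crdf :: "'a ugraph \<Rightarrow> ('a \<Rightarrow> nat) \<Rightarrow> bool" where
  "crdf G f \<longleftrightarrow> rdf G f \<and> connected_graph (induced G (level G f 1 \<union> level G f 2))"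

definition trdf :: "'a ugraph \<Rightarrow> ('a \<Rightarrow> nat) \<Rightarrow> bool" where
  "trdf G f \<longleftrightarrow> rdf G f \<and>
     (\<forall>v\<in>level G f 1 \<union> level G f 2. \<exists>u\<in>level G f 1 \<union> level G f 2. adj G v u)"

definition le_on :: "'a ugraph \<Rightarrow> ('a \<Rightarrow> nat) \<Rightarrow> ('a \<Rightarrow> nat) \<Rightarrow> bool" where
  "le_on G f g \<longleftrightarrow> (\<forall>v\<in>verts G. f v \<le> g v)"

definition minimal_in ::
  "'a ugraph \<Rightarrow> ('a ugraph \<Rightarrow> ('a \<Rightarrow> nat) \<Rightarrow> bool) \<Rightarrow> ('a \<Rightarrow> nat) \<Rightarrow> bool" where
  "minimal_in G P f \<longleftrightarrow> P G f \<and> (\<forall>g. P G g \<and> le_on G g f \<longrightarrow> g = f)"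

definition C_CRDF :: "'a ugraph \<Rightarrow> 'a set \<Rightarrow> ('a \<Rightarrow> nat) set" where
  "C_CRDF G A = {f. minimal_in G crdf f \<and> level G f 2 = A}"

definition C_TRDF :: "'a ugraph \<Rightarrow> 'a set \<Rightarrow> ('a \<Rightarrow> nat) set" where
  "C_TRDF G A = {f. minimal_in G trdf f \<and> level G f 2 = A}"

section \<open>Hitting sets\<close>

definition hitting_set :: "'a set \<Rightarrow> 'a set set \<Rightarrow> 'a set \<Rightarrow> bool" where
  "hitting_set X S D \<longleftrightarrow> D \<subseteq> X \<and> (\<forall>s\<in>S. D \<inter> s \<noteq> {})"

definition minimal_hitting_sets :: "'a set \<Rightarrow> 'a set set \<Rightarrow> 'a set set" where
  "minimal_hitting_sets X S =
     {D. hitting_set X S D \<and> (\<forall>D'. hitting_set X S D' \<and> D' \<subseteq> D \<longrightarrow> D' = D)}"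

section \<open>Machine model\<close>

text \<open>While programs over finitely many stacks of symbols from a fixed finite alphabet. Two stacks
  represent one tape together with its head position, and every unit of time inspects or changes
  the top of one stack, so these programs and multi-tape Turing machines simulate each other
  with constant-factor overhead.\<close>

datatype sym = S0 | S1 | S2 | Sep

type_synonym store = "nat \<Rightarrow> sym list"

definition peek :: "sym list \<Rightarrow> sym option" where
  "peek xs = (case xs of [] \<Rightarrow> None | x # _ \<Rightarrow> Some x)"

text \<open>Tests ask whether the top symbol of a stack, or \<open>None\<close> if it is empty, belongs to
  a given set.\<close>

datatype com =
    Skip
  | Push nat sym
  | Pop nat
  | Seq com com
  | IfTop nat "sym option set" com com
  | WhileTop nat "sym option set" com

text \<open>\<open>exec c s t s'\<close>: started in \<open>s\<close>, program \<open>c\<close> halts in \<open>s'\<close> after \<open>t\<close> steps.\<close>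

inductive exec :: "com \<Rightarrow> store \<Rightarrow> nat \<Rightarrow> store \<Rightarrow> bool" where
  Skip: "exec Skip s 1 s"
| Push: "exec (Push r a) s 1 (s(r := a # s r))"
| Pop: "exec (Pop r) s 1 (s(r := tl (s r)))"
| Seq: "exec c1 s t1 s' \<Longrightarrow> exec c2 s' t2 s'' \<Longrightarrow> exec (Seq c1 c2) s (t1 + t2) s''"
| IfTrue: "peek (s r) \<in> T \<Longrightarrow> exec c1 s t s' \<Longrightarrow> exec (IfTop r T c1 c2) s (t + 1) s'"
| IfFalse: "peek (s r) \<notin> T \<Longrightarrow> exec c2 s t s' \<Longrightarrow> exec (IfTop r T c1 c2) s (t + 1) s'"
| WhileFalse: "peek (s r) \<notin> T \<Longrightarrow> exec (WhileTop r T c) s 1 s"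
| WhileTrue: "peek (s r) \<in> T \<Longrightarrow> exec c s t1 s' \<Longrightarrow> exec (WhileTop r T c) s' t2 s'' \<Longrightarrow>
    exec (WhileTop r T c) s (t1 + t2 + 1) s''"

inductive_cases exec_SkipE: "exec Skip s t s'"
inductive_cases exec_PushE: "exec (Push r a) s t s'"
inductive_cases exec_PopE: "exec (Pop r) s t s'"
inductive_cases exec_SeqE: "exec (Seq c1 c2) s t s'"
inductive_cases exec_IfE: "exec (IfTop r T c1 c2) s t s'"
inductive_cases exec_WhileE: "exec (WhileTop r T c) s t s'"

lemma exec_deterministic:
  "exec c s t s' \<Longrightarrow> exec c s u s'' \<Longrightarrow> u = t \<and> s'' = s'"
  apply (induction arbitrary: u s'' rule: exec.induct)
         apply (erule exec_SkipE, simp)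
        apply (erule exec_PushE, simp)
       apply (erule exec_PopE, simp)
      apply (erule exec_SeqE, metis)
     apply (erule exec_IfE, metis Suc_eq_plus1, metis)
    apply (erule exec_IfE, metis, metis Suc_eq_plus1)
   apply (erule exec_WhileE, metis One_nat_def, metis)
  apply (erule exec_WhileE, metis, metis Suc_eq_plus1)
  done

text \<open>The input is on stack 0, its first symbol on top; all other stacks are empty. The output is
  read off stack 1.\<close>

definition init_store :: "sym list \<Rightarrow> store" where
  "init_store w = (\<lambda>_. [])(0 := w)"

section \<open>Enumeration problems\<close>

record ('i, 'o) enum_problem =
  instances :: "'i set"
  encode :: "'i \<Rightarrow> sym list"
  solutions :: "'i \<Rightarrow> 'o set"
  encode_sol :: "'i \<Rightarrow> 'o \<Rightarrow> sym list"

text \<open>On every instance the program must halt having written each solution exactly once, in any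
  order. On inputs that encode no instance it may do anything.\<close>

definition output_polynomial :: "('i, 'o) enum_problem \<Rightarrow> bool" where
  "output_polynomial P \<longleftrightarrow>
     (\<exists>(c :: com) (p :: nat poly). \<forall>x \<in> instances P. \<exists>t s ys.
        exec c (init_store (encode P x)) t s \<and>
        distinct ys \<and> set ys = solutions P x \<and>
        s 1 = concat (map (encode_sol P x) ys) \<and>
        t \<le> poly p (length (encode P x) + card (solutions P x)))"

section \<open>The enumeration problems under consideration\<close>

text \<open>Vertices and hypergraph elements are \<open>0, \<dots>, n - 1\<close>.\<close>

definition bits :: "nat \<Rightarrow> nat set \<Rightarrow> sym list" where
  "bits n B = map (\<lambda>i. if i \<in> B then S1 else S0) [0..<n] @ [Sep]"

text \<open>The adjacency matrix is symmetric with zero diagonal; its part below the diagonal is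
  stored row by row.\<close>

definition encode_graph :: "nat ugraph \<Rightarrow> sym list" where
  "encode_graph G = concat (map (\<lambda>i. bits i {j. adj G i j}) [0..<card (verts G)])"

definition encode_graph_set :: "nat ugraph \<times> nat set \<Rightarrow> sym list" where
  "encode_graph_set = (\<lambda>(G, A). encode_graph G @ bits (card (verts G)) A)"

definition encode_labelling :: "nat ugraph \<times> nat set \<Rightarrow> (nat \<Rightarrow> nat) \<Rightarrow> sym list" where
  "encode_labelling = (\<lambda>(G, A) f.
     map (\<lambda>v. if f v = 0 then S0 else if f v = 1 then S1 else S2) [0..<card (verts G)] @ [Sep])"

definition graph_set_instances :: "(nat ugraph \<Rightarrow> bool) \<Rightarrow> (nat ugraph \<times> nat set) set" where
  "graph_set_instances \<C> =
     {(G, A). simple_graph G \<and> (\<exists>n. verts G = {..<n}) \<and> A \<subseteq> verts G \<and> \<C> G}"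

definition Enum_CRDF ::
  "(nat ugraph \<Rightarrow> bool) \<Rightarrow> (nat ugraph \<times> nat set, nat \<Rightarrow> nat) enum_problem" where
  "Enum_CRDF \<C> = \<lparr>instances = graph_set_instances \<C>, encode = encode_graph_set,
     solutions = (\<lambda>(G, A). C_CRDF G A), encode_sol = encode_labelling\<rparr>"

definition Enum_TRDF ::
  "(nat ugraph \<Rightarrow> bool) \<Rightarrow> (nat ugraph \<times> nat set, nat \<Rightarrow> nat) enum_problem" where
  "Enum_TRDF \<C> = \<lparr>instances = graph_set_instances \<C>, encode = encode_graph_set,
     solutions = (\<lambda>(G, A). C_TRDF G A), encode_sol = encode_labelling\<rparr>"

text \<open>The hypergraph \<open>({..<n}, set es)\<close> is presented as \<open>n\<close> in unary followed by the rows of its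
  incidence matrix, with the hyperedges listed in an arbitrary order.\<close>

definition Enum_Tr :: "(nat \<times> nat set list, nat set) enum_problem" where
  "Enum_Tr = \<lparr>
     instances = {(n, es). distinct es \<and> (\<forall>e\<in>set es. e \<subseteq> {..<n})},
     encode = (\<lambda>(n, es). replicate n S1 @ [Sep] @ concat (map (bits n) es)),
     solutions = (\<lambda>(n, es). minimal_hitting_sets {..<n} (set es)),
     encode_sol = (\<lambda>(n, es). bits n)\<rparr>"

end

theory Submission
  imports Defs
begin

text \<open>Add the ground set \<open>X\<close> to the hyperedges, which does not change the hitting sets as soon as
  there is a hyperedge. Make \<open>X\<close> a clique; for every hyperedge \<open>e\<close> add an independent vertex
  \<open>s\<close> adjacent to the elements of \<open>e\<close>, and a clique vertex \<open>p\<close> whose only neighbour among the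
  vertices \<open>s\<close> is the one of \<open>e\<close>; let \<open>A\<close> be the set of all \<open>s\<close>. In a minimal function with
  \<open>V\<^sub>2 = A\<close> every \<open>p\<close> has value 0, which in turn prevents \<open>s\<close> from being lowered, while elements are
  already dominated through the hyperedge \<open>X\<close>. Since \<open>A\<close> is independent with at least two
  vertices, both connectedness and totality say that the elements of value 1 hit every hyperedge.
  So minimal functions with \<open>V\<^sub>2 = A\<close> correspond to minimal hitting sets, and both the graph and
  the hitting sets are computed by stack programs in polynomial time.\<close>

section \<open>Timed executions\<close>

text \<open>An upper bound in place of the exact time, so that costs add up under sequencing and can
  be rounded up.\<close>

definition runs :: "com \<Rightarrow> store \<Rightarrow> nat \<Rightarrow> store \<Rightarrow> bool" where
  "runs c s T s' \<longleftrightarrow> (\<exists>t\<le>T. exec c s t s')"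

lemma runs_mono: "runs c s T s' \<Longrightarrow> T \<le> T' \<Longrightarrow> runs c s T' s'"
  unfolding runs_def using order_trans by blast

lemma runs_Push: "s' = s(r := a # s r) \<Longrightarrow> runs (Push r a) s 1 s'"
  unfolding runs_def using exec.Push by blast

lemma runs_Pop: "s' = s(r := tl (s r)) \<Longrightarrow> runs (Pop r) s 1 s'"
  unfolding runs_def using exec.Pop by blast

lemma runs_Seq: "runs c1 s T1 s' \<Longrightarrow> runs c2 s' T2 s'' \<Longrightarrow> runs (Seq c1 c2) s (T1 + T2) s''"
  unfolding runs_def using exec.Seq add_mono by meson

lemma runs_IfTrue: "peek (s r) \<in> B \<Longrightarrow> runs c1 s T s' \<Longrightarrow> runs (IfTop r B c1 c2) s (T + 1) s'"
  unfolding runs_def using exec.IfTrue add_le_mono1 by meson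

lemma runs_IfFalse: "peek (s r) \<notin> B \<Longrightarrow> runs c2 s T s' \<Longrightarrow> runs (IfTop r B c1 c2) s (T + 1) s'"
  unfolding runs_def using exec.IfFalse add_le_mono1 by meson

lemma runs_WhileFalse: "peek (s r) \<notin> B \<Longrightarrow> runs (WhileTop r B c) s 1 s"
  unfolding runs_def using exec.WhileFalse by blast

lemma runs_WhileTrue:
  assumes "peek (s r) \<in> B" "runs c s T1 s'" "runs (WhileTop r B c) s' T2 s''"
  shows "runs (WhileTop r B c) s (T1 + T2 + 1) s''"
  using assms unfolding runs_def by (meson exec.WhileTrue add_mono order_refl)

text \<open>\<open>S i\<close> is the store after \<open>i\<close> rounds. Each round pays
  \<open>b\<close> plus one for the test, and the last \<open>1\<close> is the failing test.\<close>

lemma runs_While_iterate: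
  assumes "\<And>i. i < m \<Longrightarrow> peek (S i r) \<in> B"
    and "\<And>i. i < m \<Longrightarrow> runs c (S i) b (S (Suc i))"
    and "peek (S m r) \<notin> B"
  shows "runs (WhileTop r B c) (S 0) (m * (b + 1) + 1) (S m)"
  using assms
proof (induction m arbitrary: S)
  case 0
  then show ?case using runs_WhileFalse by simp
next
  case (Suc m)
  have "runs (WhileTop r B c) (S (Suc 0)) (m * (b + 1) + 1) (S (Suc m))"
    using Suc.prems by (intro Suc.IH[of "\<lambda>i. S (Suc i)"]) auto
  then have "runs (WhileTop r B c) (S 0) (b + (m * (b + 1) + 1) + 1) (S (Suc m))"
    using Suc.prems by (intro runs_WhileTrue) auto
  then show ?case by (rule runs_mono) simp
qed

section \<open>Moving words between stacks\<close>

fun push_all :: "nat \<Rightarrow> sym list \<Rightarrow> com" where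
  "push_all k [] = Skip"
| "push_all k (a # w) = Seq (Push k a) (push_all k w)"

text \<open>Pushing from the front puts the first symbol deepest, hence \<open>rev w\<close>; the
  closing \<open>Skip\<close> is the extra step behind the strict bound.\<close>

lemma runs_push_all:
  "length w < T \<Longrightarrow> s' = s(k := rev w @ s k) \<Longrightarrow> runs (push_all k w) s T s'"
proof (induction w arbitrary: s s' T)
  case Nil
  then have "exec (push_all k []) s 1 s'" using exec.Skip by simp
  then show ?case using Nil unfolding runs_def by (metis One_nat_def Suc_leI list.size(3))
next
  case (Cons a w)
  have "runs (push_all k w) (s(k := a # s k)) (T - 1) s'"
    using Cons.prems by (intro Cons.IH) auto
  then have "runs (push_all k (a # w)) s (1 + (T - 1)) s'"
    unfolding push_all.simps by (intro runs_Seq[OF runs_Push]) auto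
  then show ?case by (rule runs_mono) (use Cons.prems in auto)
qed

text \<open>A test has only two outcomes, so four symbols take three nested tests;
  \<open>Sep\<close> is the default, which is sound only on a nonempty stack.\<close>

definition dispatch :: "nat \<Rightarrow> (sym \<Rightarrow> com) \<Rightarrow> com" where
  "dispatch r f = IfTop r {Some S0} (f S0) (IfTop r {Some S1} (f S1)
     (IfTop r {Some S2} (f S2) (f Sep)))"

lemma runs_dispatch:
  assumes "s r = x # v" "runs (f x) s T s'"
  shows "runs (dispatch r f) s (T + 3) s'"
proof -
  have p: "peek (s r) = Some x" using assms by (simp add: peek_def)
  have step: "runs (IfTop r {Some y} c1 c2) s (U + 1) s'"
    if "runs (if x = y then c1 else c2) s U s'" for y c1 c2 U
    using that p by (auto intro: runs_IfTrue runs_IfFalse simp del: One_nat_def split: if_splits)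
  have "runs (dispatch r f) s (T + 1 + 1 + 1) s'"
    unfolding dispatch_def
    by (rule step, cases "x = S0", use assms(2) in \<open>force elim: runs_mono\<close>, simp only: if_False,
        rule step, cases "x = S1", use assms(2) in \<open>force elim: runs_mono\<close>, simp only: if_False,
        rule step, cases x, use assms(2) in auto)
  then show ?thesis by (simp add: numeral_3_eq_3)
qed

text \<open>Reading a stack destroys it, so a copy is made by draining into two targets at once and
  draining one of them back. A plain move lets the second target receive empty words. Translating
  each symbol into a word also expands a unary counter into a repeated pattern.\<close>

definition drain ::
  "nat \<Rightarrow> sym set \<Rightarrow> nat \<Rightarrow> (sym \<Rightarrow> sym list) \<Rightarrow> nat \<Rightarrow> (sym \<Rightarrow> sym list) \<Rightarrow> com" where
  "drain r B k g k' g' = WhileTop r (Some ` B)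
     (Seq (dispatch r (\<lambda>x. Seq (push_all k (g x)) (push_all k' (g' x)))) (Pop r))"

text \<open>Each symbol costs at most 11 steps: 3 for each \<open>push_all\<close>, 3 for
  \<open>dispatch\<close>, one for \<open>Pop\<close> and one for the loop test. The condition on
  \<open>u\<close> stops the loop exactly at the end of \<open>w\<close>.\<close>

lemma runs_drain:
  assumes "s r = w @ u" "set w \<subseteq> B" "peek u \<notin> Some ` B"
    and "r \<noteq> k" "r \<noteq> k'" "k \<noteq> k'"
    and "\<And>x. length (g x) \<le> 2" "\<And>x. length (g' x) \<le> 2"
    and "s' = s(r := u, k := rev (concat (map g w)) @ s k, k' := rev (concat (map g' w)) @ s k')"
    and "11 * length w < T"
  shows "runs (drain r B k g k' g') s T s'"
  using assms(1,2,9,10)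
proof (induction w arbitrary: s s' T)
  case Nil
  have "s' = s" using Nil by auto
  moreover have "runs (drain r B k g k' g') s 1 s"
    unfolding drain_def using Nil assms(3) by (intro runs_WhileFalse) auto
  ultimately show ?case using Nil(4) by (auto elim: runs_mono)
next
  case (Cons x w)
  let ?s1 = "s(k := rev (g x) @ s k, k' := rev (g' x) @ s k')"
  let ?s2 = "?s1(r := w @ u)"
  have "runs (Seq (push_all k (g x)) (push_all k' (g' x))) s (3 + 3) ?s1"
    by (rule runs_Seq; rule runs_push_all[OF _ refl, THEN runs_mono[OF _ order_refl]] runs_push_all)
       (use assms(6-8) in \<open>auto simp: le_imp_less_Suc numeral_3_eq_3 numeral_2_eq_2\<close>)
  then have "runs (dispatch r (\<lambda>x. Seq (push_all k (g x)) (push_all k' (g' x)))) s (3 + 3 + 3) ?s1"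
    using Cons.prems(1) by (intro runs_dispatch) auto
  then have body: "runs (Seq (dispatch r (\<lambda>x. Seq (push_all k (g x)) (push_all k' (g' x)))) (Pop r))
      s (3 + 3 + 3 + 1) ?s2"
    by (rule runs_Seq, intro runs_Pop) (use Cons.prems(1) assms(4,5) in auto)
  have "runs (drain r B k g k' g') ?s2 (T - 11) s'"
    using Cons.prems assms(4-6) by (intro Cons.IH) (auto simp: fun_eq_iff)
  then have "runs (drain r B k g k' g') s (3 + 3 + 3 + 1 + (T - 11) + 1) s'"
    unfolding drain_def using body Cons.prems(1,2)
    by (intro runs_WhileTrue[of _ _ _ _ _ ?s2]) (auto simp: peek_def)
  then show ?case by (rule runs_mono) (use Cons.prems in auto)
qed

section \<open>The reduction program\<close>

text \<open>The reduction keeps its input on stack 0, the number of hypergraph elements in unary on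
  stack 2, the number of finished hyperedges in unary on stack 5, and the reversed output on
  stack 4. Stack 3 is scratch space and stack 6 a dummy target that never receives a symbol.\<close>

definition store6 ::
  "sym list \<Rightarrow> sym list \<Rightarrow> sym list \<Rightarrow> sym list \<Rightarrow> sym list \<Rightarrow> sym list \<Rightarrow> store" where
  "store6 a b c d e f = (\<lambda>_. [])(0 := a, 1 := b, 2 := c, 3 := d, 4 := e, 5 := f)"

lemma store6_apply [simp]:
  "store6 a b c d e f 0 = a" "store6 a b c d e f (Suc 0) = b" "store6 a b c d e f 2 = c"
  "store6 a b c d e f 3 = d" "store6 a b c d e f 4 = e" "store6 a b c d e f 5 = f"
  "store6 a b c d e f 6 = []"
  by (simp_all add: store6_def)

lemma store6_upd [simp]:
  "(store6 a b c d e f)(0 := x) = store6 x b c d e f"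
  "(store6 a b c d e f)(Suc 0 := x) = store6 a x c d e f"
  "(store6 a b c d e f)(2 := x) = store6 a b x d e f"
  "(store6 a b c d e f)(3 := x) = store6 a b c x e f"
  "(store6 a b c d e f)(4 := x) = store6 a b c d x f"
  "(store6 a b c d e f)(5 := x) = store6 a b c d e x"
  "(store6 a b c d e f)(6 := []) = store6 a b c d e f"
  by (auto simp add: store6_def fun_eq_iff)

lemma peek_Nil [simp]: "peek [] = None" and peek_Cons [simp]: "peek (x # xs) = Some x"
  by (simp_all add: peek_def)

abbreviation ones :: "nat \<Rightarrow> sym list" where "ones n \<equiv> replicate n S1"

section \<open>Reading the number of elements, and the answer without hyperedges\<close>

definition read_size :: com where
  "read_size = Seq (drain 0 {S1} 2 (\<lambda>x. [x]) 6 (\<lambda>_. [])) (Pop 0)"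

lemma runs_read_size:
  "runs read_size (store6 (ones n @ Sep # w) [] [] [] [] []) (11 * n + 2)
     (store6 w [] (ones n) [] [] [])"
proof -
  have "runs read_size (store6 (ones n @ Sep # w) [] [] [] [] []) (11 * n + 1 + 1)
     (store6 w [] (ones n) [] [] [])"
    unfolding read_size_def
    by (rule runs_Seq[OF runs_drain[OF _ _ _ _ _ _ _ _ refl]])
       (auto intro!: runs_Pop[THEN runs_mono] simp: concat_replicate_trivial)
  then show ?thesis by (rule runs_mono) simp
qed

text \<open>Without hyperedges the empty set is the only minimal hitting set. Its code is written
  from the bottom, so the separator comes first.\<close>

definition empty_answer :: com where
  "empty_answer = Seq (Push 1 Sep) (drain 2 {S1} 1 (\<lambda>_. [S0]) 6 (\<lambda>_. []))"

lemma runs_empty_answer: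
  "runs empty_answer (store6 [] [] (ones n) [] [] []) (11 * n + 2)
     (store6 [] (replicate n S0 @ [Sep]) [] [] [] [])"
proof -
  have "concat (replicate n [S0]) = replicate n S0" by (induction n) auto
  then have "runs empty_answer (store6 [] [] (ones n) [] [] []) (1 + (11 * n + 1))
     (store6 [] (replicate n S0 @ [Sep]) [] [] [] [])"
    unfolding empty_answer_def
    by (intro runs_Seq[OF runs_Push[OF refl]] runs_drain[of _ _ "ones n" "[]"]) auto
  then show ?thesis by (rule runs_mono) simp
qed

lemma init_store_eq: "init_store w = store6 w [] [] [] [] []"
  by (auto simp: init_store_def store6_def fun_eq_iff)

lemma concat_map_Nil [simp]: "concat (map (\<lambda>_. []) xs) = []"
  by (induction xs) auto

lemma concat_replicate_single [simp]: "concat (replicate n [x]) = replicate n x"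
  by (induction n) auto

section \<open>Writing the rows of the adjacency matrix\<close>

definition clique_rows :: "nat \<Rightarrow> sym list" where
  "clique_rows n = concat (map (\<lambda>i. ones i @ [Sep]) [0..<n])"

text \<open>Stack 3 counts the finished rows, which is also the number of ones in the next row,
  since row \<open>i\<close> of a clique has a one for each smaller vertex. Stack 5 only serves to
  restore it. At the end the value \<open>n\<close> has moved from stack 2 to stack 3.\<close>

definition write_clique :: com where
  "write_clique = WhileTop 2 {Some S1}
     (Seq (Pop 2) (Seq (drain 3 {S1} 5 (\<lambda>x. [x]) 4 (\<lambda>x. [x]))
       (Seq (drain 5 {S1} 3 (\<lambda>x. [x]) 6 (\<lambda>_. [])) (Seq (Push 4 Sep) (Push 3 S1)))))"

lemma runs_write_clique:
  "runs write_clique (store6 w [] (ones n) [] [] []) (n * (22 * n + 6) + 1)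
     (store6 w [] [] (ones n) (rev (clique_rows n)) [])"
proof -
  let ?S = "\<lambda>i. store6 w [] (ones (n - i)) (ones i) (rev (clique_rows i)) []"
  let ?body = "Seq (Pop 2) (Seq (drain 3 {S1} 5 (\<lambda>x. [x]) 4 (\<lambda>x. [x]))
       (Seq (drain 5 {S1} 3 (\<lambda>x. [x]) 6 (\<lambda>_. [])) (Seq (Push 4 Sep) (Push 3 S1))))"
  have body: "runs ?body (?S i) (22 * n + 5) (?S (Suc i))" if i: "i < n" for i
  proof -
    have "runs ?body (?S i) (1 + (11 * i + 1 + (11 * i + 1 + (1 + 1)))) (?S (Suc i))"
    proof (intro runs_Seq)
      show "runs (Pop 2) (?S i) 1
          (store6 w [] (ones (n - Suc i)) (ones i) (rev (clique_rows i)) [])"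
        using i by (intro runs_Pop) simp
      show "runs (drain 3 {S1} 5 (\<lambda>x. [x]) 4 (\<lambda>x. [x]))
          (store6 w [] (ones (n - Suc i)) (ones i) (rev (clique_rows i)) []) (11 * i + 1)
          (store6 w [] (ones (n - Suc i)) [] (ones i @ rev (clique_rows i)) (ones i))"
        by (rule runs_drain[of _ _ "ones i" "[]"]) auto
      show "runs (drain 5 {S1} 3 (\<lambda>x. [x]) 6 (\<lambda>_. []))
          (store6 w [] (ones (n - Suc i)) [] (ones i @ rev (clique_rows i)) (ones i)) (11 * i + 1)
          (store6 w [] (ones (n - Suc i)) (ones i) (ones i @ rev (clique_rows i)) [])"
        by (rule runs_drain[of _ _ "ones i" "[]"]) auto
      show "runs (Push 4 Sep)
          (store6 w [] (ones (n - Suc i)) (ones i) (ones i @ rev (clique_rows i)) []) 1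
          (store6 w [] (ones (n - Suc i)) (ones i) (rev (clique_rows (Suc i))) [])"
        by (rule runs_Push) (simp add: clique_rows_def)
      show "runs (Push 3 S1)
          (store6 w [] (ones (n - Suc i)) (ones i) (rev (clique_rows (Suc i))) []) 1 (?S (Suc i))"
        by (rule runs_Push) simp
    qed
    then show ?thesis by (rule runs_mono) (use i in simp)
  qed
  have "runs write_clique (?S 0) (n * (22 * n + 5 + 1) + 1) (?S n)"
    unfolding write_clique_def
  proof (rule runs_While_iterate[where S = ?S])
    show "peek (?S i 2) \<in> {Some S1}" if "i < n" for i
      using that by (cases "n - i") auto
  qed (use body in auto)
  then show ?thesis by (simp add: clique_rows_def add.commute)
qed

text \<open>The rows of the two vertices owned by hyperedge \<open>k\<close>. The pairs
  \<open>[S0, S0]\<close> and \<open>[S0, S1]\<close> are the entries at an earlier hyperedge vertex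
  and its private neighbour: the first row avoids both, the second is joined to private neighbours
  only. The last \<open>S1\<close> joins the new private neighbour to its own hyperedge
  vertex.\<close>

definition gadget_rows :: "nat \<Rightarrow> nat set \<Rightarrow> nat \<Rightarrow> sym list" where
  "gadget_rows n e k = map (\<lambda>i. if i \<in> e then S1 else S0) [0..<n] @ concat (replicate k [S0, S0])
     @ [Sep] @ ones n @ concat (replicate k [S0, S1]) @ [S1, Sep]"

text \<open>The counters on stacks 5 and 2 are needed again for later hyperedges, so every use also
  copies them to stack 3 and is followed by a drain back. The final push raises the count of
  finished hyperedges.\<close>

definition write_gadget :: com where
  "write_gadget =
     Seq (drain 0 {S0, S1} 4 (\<lambda>x. [x]) 6 (\<lambda>_. []))
    (Seq (Pop 0)
    (Seq (drain 5 {S1} 3 (\<lambda>x. [x]) 4 (\<lambda>_. [S0, S0]))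
    (Seq (drain 3 {S1} 5 (\<lambda>x. [x]) 6 (\<lambda>_. []))
    (Seq (Push 4 Sep)
    (Seq (drain 2 {S1} 3 (\<lambda>x. [x]) 4 (\<lambda>x. [x]))
    (Seq (drain 3 {S1} 2 (\<lambda>x. [x]) 6 (\<lambda>_. []))
    (Seq (drain 5 {S1} 3 (\<lambda>x. [x]) 4 (\<lambda>_. [S0, S1]))
    (Seq (drain 3 {S1} 5 (\<lambda>x. [x]) 6 (\<lambda>_. []))
    (Seq (push_all 4 [S1, Sep])
    (Push 5 S1))))))))))"

lemma runs_write_gadget:
  "runs write_gadget (store6 (bits n e @ u) [] (ones n) [] w (ones k)) (33 * n + 44 * k + 13)
     (store6 u [] (ones n) [] (rev (gadget_rows n e k) @ w) (ones (Suc k)))"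
proof -
  let ?b = "map (\<lambda>i. if i \<in> e then S1 else S0) [0..<n]"
  let ?z = "concat (replicate k [S0, S0])"
  let ?p = "concat (replicate k [S0, S1])"
  let ?w1 = "rev ?b @ w"
  let ?w2 = "rev ?z @ ?w1"
  let ?w3 = "ones n @ Sep # ?w2"
  let ?w4 = "rev ?p @ ?w3"
  have "runs write_gadget (store6 (bits n e @ u) [] (ones n) [] w (ones k))
     ((11 * n + 1) + (1 + ((11 * k + 1) + ((11 * k + 1) + (1 + ((11 * n + 1) + ((11 * n + 1) +
       ((11 * k + 1) + ((11 * k + 1) + (3 + 1))))))))))
     (store6 u [] (ones n) [] (rev (gadget_rows n e k) @ w) (ones (Suc k)))"
    unfolding write_gadget_def
  proof (intro runs_Seq)
    show "runs (drain 0 {S0, S1} 4 (\<lambda>x. [x]) 6 (\<lambda>_. []))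
        (store6 (bits n e @ u) [] (ones n) [] w (ones k)) (11 * n + 1)
        (store6 (Sep # u) [] (ones n) [] ?w1 (ones k))"
      by (rule runs_drain[of _ _ ?b "Sep # u"]) (auto simp: bits_def simp del: map_map)
    show "runs (Pop 0) (store6 (Sep # u) [] (ones n) [] ?w1 (ones k)) 1
        (store6 u [] (ones n) [] ?w1 (ones k))"
      by (rule runs_Pop) simp
    show "runs (drain 5 {S1} 3 (\<lambda>x. [x]) 4 (\<lambda>_. [S0, S0]))
        (store6 u [] (ones n) [] ?w1 (ones k)) (11 * k + 1)
        (store6 u [] (ones n) (ones k) ?w2 [])"
      by (rule runs_drain[of _ _ "ones k" "[]"]) auto
    show "runs (drain 3 {S1} 5 (\<lambda>x. [x]) 6 (\<lambda>_. []))
        (store6 u [] (ones n) (ones k) ?w2 []) (11 * k + 1)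
        (store6 u [] (ones n) [] ?w2 (ones k))"
      by (rule runs_drain[of _ _ "ones k" "[]"]) auto
    show "runs (Push 4 Sep) (store6 u [] (ones n) [] ?w2 (ones k)) 1
        (store6 u [] (ones n) [] (Sep # ?w2) (ones k))"
      by (rule runs_Push) simp
    show "runs (drain 2 {S1} 3 (\<lambda>x. [x]) 4 (\<lambda>x. [x]))
        (store6 u [] (ones n) [] (Sep # ?w2) (ones k)) (11 * n + 1)
        (store6 u [] [] (ones n) ?w3 (ones k))"
      by (rule runs_drain[of _ _ "ones n" "[]"]) auto
    show "runs (drain 3 {S1} 2 (\<lambda>x. [x]) 6 (\<lambda>_. []))
        (store6 u [] [] (ones n) ?w3 (ones k)) (11 * n + 1)
        (store6 u [] (ones n) [] ?w3 (ones k))"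
      by (rule runs_drain[of _ _ "ones n" "[]"]) auto
    show "runs (drain 5 {S1} 3 (\<lambda>x. [x]) 4 (\<lambda>_. [S0, S1]))
        (store6 u [] (ones n) [] ?w3 (ones k)) (11 * k + 1)
        (store6 u [] (ones n) (ones k) ?w4 [])"
      by (rule runs_drain[of _ _ "ones k" "[]"]) auto
    show "runs (drain 3 {S1} 5 (\<lambda>x. [x]) 6 (\<lambda>_. []))
        (store6 u [] (ones n) (ones k) ?w4 []) (11 * k + 1)
        (store6 u [] (ones n) [] ?w4 (ones k))"
      by (rule runs_drain[of _ _ "ones k" "[]"]) auto
    show "runs (push_all 4 [S1, Sep]) (store6 u [] (ones n) [] ?w4 (ones k)) 3
        (store6 u [] (ones n) [] (Sep # S1 # ?w4) (ones k))"
      by (rule runs_push_all) auto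
    show "runs (Push 5 S1) (store6 u [] (ones n) [] (Sep # S1 # ?w4) (ones k)) 1
        (store6 u [] (ones n) [] (rev (gadget_rows n e k) @ w) (ones (Suc k)))"
      by (rule runs_Push) (simp add: gadget_rows_def)
  qed
  then show ?thesis by (rule runs_mono) simp
qed

text \<open>After the matrix comes the bit row of \<open>A\<close>: zeros for the elements, then a
  one and a zero for each hyperedge vertex and its private neighbour.\<close>

definition graph_code :: "nat \<Rightarrow> nat set list \<Rightarrow> sym list" where
  "graph_code n es = clique_rows n @
     concat (map (\<lambda>k. gadget_rows n (es ! k) k) [0..<length es]) @
     replicate n S0 @ concat (replicate (length es) [S1, S0]) @ [Sep]"

lemma runs_write_gadgets:
  "runs (WhileTop 0 {Some S0, Some S1, Some Sep} write_gadget)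
     (store6 (concat (map (bits n) es)) [] (ones n) [] w [])
     (length es * (33 * n + 44 * length es + 14) + 1)
     (store6 [] [] (ones n) []
        (rev (concat (map (\<lambda>k. gadget_rows n (es ! k) k) [0..<length es])) @ w) (ones (length es)))"
proof -
  let ?m = "length es"
  let ?S = "\<lambda>k. store6 (concat (map (bits n) (drop k es))) [] (ones n) []
        (rev (concat (map (\<lambda>k. gadget_rows n (es ! k) k) [0..<k])) @ w) (ones k)"
  have drop: "concat (map (bits n) (drop k es)) =
      bits n (es ! k) @ concat (map (bits n) (drop (Suc k) es))" if "k < ?m" for k
    using that by (simp flip: Cons_nth_drop_Suc)
  have "runs (WhileTop 0 {Some S0, Some S1, Some Sep} write_gadget) (?S 0)
      (?m * (33 * n + 44 * ?m + 13 + 1) + 1) (?S ?m)"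
  proof (rule runs_While_iterate[where S = ?S])
    fix k assume k: "k < ?m"
    \<comment> \<open>For \<open>n = 0\<close> a row consists of \<open>Sep\<close> alone, which is
      why the loop guard accepts this symbol.\<close>
    obtain x v where xv: "bits n (es ! k) = x # v" "x \<noteq> S2"
      by (cases n) (auto simp: bits_def upt_conv_Cons simp del: upt_Suc)
    then show "peek (?S k 0) \<in> {Some S0, Some S1, Some Sep}"
      unfolding drop[OF k] by (cases x) auto
    show "runs write_gadget (?S k) (33 * n + 44 * ?m + 13) (?S (Suc k))"
      unfolding drop[OF k] using runs_mono[OF runs_write_gadget] k by simp
  qed simp
  then show ?thesis by (simp add: algebra_simps)
qed

text \<open>Draining \<open>ones n\<close> from stack 3 onto a fresh \<open>Sep\<close> both
  restores stack 2 and puts the ground set in front as a new first hyperedge. The bit row of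
  \<open>A\<close> is then written from the two counters. The final drain turns the reversed output
  round onto stack 0 and leaves all other stacks empty, as the assumed enumeration program
  expects.\<close>

definition write_graph :: com where
  "write_graph =
     Seq write_clique
    (Seq (Push 0 Sep)
    (Seq (drain 3 {S1} 2 (\<lambda>x. [x]) 0 (\<lambda>x. [x]))
    (Seq (WhileTop 0 {Some S0, Some S1, Some Sep} write_gadget)
    (Seq (drain 2 {S1} 4 (\<lambda>_. [S0]) 6 (\<lambda>_. []))
    (Seq (drain 5 {S1} 4 (\<lambda>_. [S1, S0]) 6 (\<lambda>_. []))
    (Seq (Push 4 Sep)
    (drain 4 UNIV 0 (\<lambda>x. [x]) 6 (\<lambda>_. []))))))))"

lemma runs_write_graph:
  fixes es n
  defines "es' \<equiv> {..<n} # es"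
  defines "m \<equiv> length es'"
  shows "runs write_graph (store6 (concat (map (bits n) es)) [] (ones n) [] [] [])
     (n * (22 * n + 6) + m * (33 * n + 44 * m + 14) + 22 * n + 11 * m
       + 11 * length (graph_code n es') + 8)
     (init_store (graph_code n es'))"
proof -
  let ?v = "concat (map (bits n) es)"
  let ?c = "rev (clique_rows n)"
  let ?d = "rev (concat (map (\<lambda>k. gadget_rows n (es' ! k) k) [0..<m])) @ ?c"
  let ?d1 = "replicate n S0 @ ?d"
  let ?d2 = "rev (concat (replicate m [S1, S0])) @ ?d1"
  have full: "ones n @ Sep # ?v = concat (map (bits n) es')"
    by (auto simp: es'_def bits_def intro!: nth_equalityI)
  have code: "rev (Sep # ?d2) = graph_code n es'"
    by (simp add: graph_code_def m_def)
  have "runs write_graph (store6 ?v [] (ones n) [] [] [])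
     ((n * (22 * n + 6) + 1) + (1 + ((11 * n + 1) + ((m * (33 * n + 44 * m + 14) + 1) +
       ((11 * n + 1) + ((11 * m + 1) + (1 + (11 * length (graph_code n es') + 1))))))))
     (init_store (graph_code n es'))"
    unfolding write_graph_def
  proof (intro runs_Seq)
    show "runs write_clique (store6 ?v [] (ones n) [] [] []) (n * (22 * n + 6) + 1)
        (store6 ?v [] [] (ones n) ?c [])"
      by (rule runs_write_clique)
    show "runs (Push 0 Sep) (store6 ?v [] [] (ones n) ?c []) 1
        (store6 (Sep # ?v) [] [] (ones n) ?c [])"
      by (rule runs_Push) simp
    show "runs (drain 3 {S1} 2 (\<lambda>x. [x]) 0 (\<lambda>x. [x]))
        (store6 (Sep # ?v) [] [] (ones n) ?c []) (11 * n + 1)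
        (store6 (concat (map (bits n) es')) [] (ones n) [] ?c [])"
      by (rule runs_drain[of _ _ "ones n" "[]"]) (auto simp flip: full)
    show "runs (WhileTop 0 {Some S0, Some S1, Some Sep} write_gadget)
        (store6 (concat (map (bits n) es')) [] (ones n) [] ?c [])
        (m * (33 * n + 44 * m + 14) + 1) (store6 [] [] (ones n) [] ?d (ones m))"
      unfolding m_def by (rule runs_write_gadgets)
    show "runs (drain 2 {S1} 4 (\<lambda>_. [S0]) 6 (\<lambda>_. []))
        (store6 [] [] (ones n) [] ?d (ones m)) (11 * n + 1) (store6 [] [] [] [] ?d1 (ones m))"
      by (rule runs_drain[of _ _ "ones n" "[]"]) auto
    show "runs (drain 5 {S1} 4 (\<lambda>_. [S1, S0]) 6 (\<lambda>_. []))
        (store6 [] [] [] [] ?d1 (ones m)) (11 * m + 1) (store6 [] [] [] [] ?d2 [])"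
      by (rule runs_drain[of _ _ "ones m" "[]"]) auto
    show "runs (Push 4 Sep) (store6 [] [] [] [] ?d2 []) 1 (store6 [] [] [] [] (Sep # ?d2) [])"
      by (rule runs_Push) simp
    show "runs (drain 4 UNIV 0 (\<lambda>x. [x]) 6 (\<lambda>_. []))
        (store6 [] [] [] [] (Sep # ?d2) []) (11 * length (graph_code n es') + 1)
        (init_store (graph_code n es'))"
      unfolding code[symmetric] init_store_eq
      by (rule runs_drain[of _ _ "Sep # ?d2" "[]"]) simp_all
  qed
  then show ?thesis by (rule runs_mono) simp
qed

section \<open>Turning labellings back into hitting sets\<close>

fun written_stacks :: "com \<Rightarrow> nat set" where
  "written_stacks Skip = {}"
| "written_stacks (Push r a) = {r}"
| "written_stacks (Pop r) = {r}"
| "written_stacks (Seq c1 c2) = written_stacks c1 \<union> written_stacks c2"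
| "written_stacks (IfTop r B c1 c2) = written_stacks c1 \<union> written_stacks c2"
| "written_stacks (WhileTop r B c) = written_stacks c"

lemma finite_written_stacks: "finite (written_stacks c)"
  by (induction c) auto

text \<open>The assumed enumeration program may leave anything on the stacks it writes. A further
  stack outside this finite set is still empty afterwards and serves as scratch space.\<close>

lemma exec_unwritten_stack: "exec c s t s' \<Longrightarrow> k \<notin> written_stacks c \<Longrightarrow> s' k = s k"
  by (induction rule: exec.induct) auto

text \<open>In each answer the element labels end at the first \<open>S2\<close>; the rest up to
  \<open>Sep\<close> is dropped. Stack \<open>k\<close> collects the result reversed, and the last
  drain turns it round. Stack 0 is a dummy target: it may hold leftovers, but only empty words are
  pushed on it.\<close>

definition truncate_answers :: "nat \<Rightarrow> com" where
  "truncate_answers k =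
     Seq (WhileTop 1 (range Some)
       (Seq (drain 1 {S0, S1} k (\<lambda>x. [x]) 0 (\<lambda>_. []))
       (Seq (drain 1 {S0, S1, S2} k (\<lambda>_. []) 0 (\<lambda>_. []))
       (Seq (Pop 1) (Push k Sep)))))
     (drain k UNIV 1 (\<lambda>x. [x]) 0 (\<lambda>_. []))"

lemma runs_truncate_answers:
  assumes k: "k > 1" and s: "s k = []"
    and s1: "s 1 = concat (map (\<lambda>D. map (\<lambda>i. if i \<in> D then S1 else S0) [0..<n] @ S2 # r @ [Sep]) Ds)"
    and r: "set r \<subseteq> {S0, S1, S2}"
  shows "\<exists>s'. runs (truncate_answers k) s
      (length Ds * (22 * n + 11 * length r + 27) + 2) s' \<and> s' 1 = concat (map (bits n) Ds)"
proof -
  let ?b = "\<lambda>D. map (\<lambda>i. if i \<in> D then S1 else S0) [0..<n]"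
  let ?w = "\<lambda>j. concat (map (\<lambda>D. ?b D @ S2 # r @ [Sep]) (drop j Ds))"
  let ?S = "\<lambda>j. s(1 := ?w j, k := rev (concat (map (bits n) (take j Ds))))"
  let ?body = "Seq (drain 1 {S0, S1} k (\<lambda>x. [x]) 0 (\<lambda>_. []))
       (Seq (drain 1 {S0, S1, S2} k (\<lambda>_. []) 0 (\<lambda>_. []))
       (Seq (Pop 1) (Push k Sep)))"
  let ?l = "length Ds"
  have drop: "?w j = ?b (Ds ! j) @ S2 # r @ Sep # ?w (Suc j)" if "j < ?l" for j
    using that by (simp flip: Cons_nth_drop_Suc)
  have "runs (WhileTop 1 (range Some) ?body) (?S 0) (?l * (11 * n + 11 * length r + 15 + 1) + 1) (?S ?l)"
  proof (rule runs_While_iterate[where S = ?S])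
    fix j assume j: "j < ?l"
    show "peek (?S j 1) \<in> range Some"
      using k unfolding drop[OF j] by (cases "?b (Ds ! j)") auto
    let ?a = "rev (concat (map (bits n) (take j Ds)))"
    let ?s1 = "s(1 := S2 # r @ Sep # ?w (Suc j), k := rev (?b (Ds ! j)) @ ?a)"
    let ?s2 = "s(1 := Sep # ?w (Suc j), k := rev (?b (Ds ! j)) @ ?a)"
    let ?s3 = "s(1 := ?w (Suc j), k := rev (?b (Ds ! j)) @ ?a)"
    have "runs ?body (?S j) ((11 * n + 1) + ((11 * (length r + 1) + 1) + (1 + 1))) (?S (Suc j))"
    proof (intro runs_Seq)
      show "runs (drain 1 {S0, S1} k (\<lambda>x. [x]) 0 (\<lambda>_. [])) (?S j) (11 * n + 1) ?s1"
        unfolding drop[OF j]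
        by (rule runs_drain[of _ _ "?b (Ds ! j)" "S2 # r @ Sep # ?w (Suc j)"])
           (use k in \<open>auto simp: fun_eq_iff simp del: map_map\<close>)
      show "runs (drain 1 {S0, S1, S2} k (\<lambda>_. []) 0 (\<lambda>_. [])) ?s1 (11 * (length r + 1) + 1) ?s2"
        by (rule runs_drain[of _ _ "S2 # r" "Sep # ?w (Suc j)"])
           (use k r in \<open>auto simp: fun_eq_iff\<close>)
      show "runs (Pop 1) ?s2 1 ?s3" by (rule runs_Pop) (use k in \<open>auto simp: fun_eq_iff\<close>)
      show "runs (Push k Sep) ?s3 1 (?S (Suc j))"
        by (rule runs_Push) (use k j in \<open>auto simp: fun_eq_iff take_Suc_conv_app_nth bits_def\<close>)
    qed
    then show "runs ?body (?S j) (11 * n + 11 * length r + 15) (?S (Suc j))"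
      by (rule runs_mono) simp
  qed (use k in auto)
  moreover have "?S 0 = s" using k s s1 by (auto simp: fun_eq_iff)
  ultimately have loop: "runs (WhileTop 1 (range Some) ?body) s
      (?l * (11 * n + 11 * length r + 16) + 1) (?S ?l)" by (simp add: add.commute)
  let ?o = "concat (map (bits n) Ds)"
  have len: "length ?o = ?l * (n + 1)"
    by (induction Ds) (auto simp: bits_def)
  have "runs (drain k UNIV 1 (\<lambda>x. [x]) 0 (\<lambda>_. [])) (?S ?l) (11 * (?l * (n + 1)) + 1)
      (s(1 := ?o, k := []))"
    by (rule runs_drain[of _ _ "rev ?o" "[]"]) (use k len in \<open>auto simp: fun_eq_iff\<close>)
  then have "runs (truncate_answers k) s
      (?l * (11 * n + 11 * length r + 16) + 1 + (11 * (?l * (n + 1)) + 1)) (s(1 := ?o, k := []))"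
    unfolding truncate_answers_def by (intro runs_Seq[OF loop])
  then have "runs (truncate_answers k) s (?l * (22 * n + 11 * length r + 27) + 2) (s(1 := ?o, k := []))"
    by (rule runs_mono) (simp add: algebra_simps)
  then show ?thesis using k by (intro exI[of _ "s(1 := ?o, k := [])"]) auto
qed

section \<open>Minimal Roman dominating functions of the gadget graph\<close>

text \<open>The reduced graph freed from its numbering. \<open>E 0 = X\<close> lets
  \<open>sv 0\<close> dominate every element, and \<open>two_le\<close> provides a second vertex of
  value 2, which the connectedness argument needs.\<close>

locale gadget =
  fixes G :: "'a ugraph" and X :: "'a set" and m :: nat and E :: "nat \<Rightarrow> 'a set"
    and sv pv :: "nat \<Rightarrow> 'a"
  assumes verts_eq: "verts G = X \<union> sv ` {..<m} \<union> pv ` {..<m}"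
    and sv_notin: "\<And>k. sv k \<notin> X" and pv_notin: "\<And>k. pv k \<notin> X"
    and sv_pv: "\<And>k l. sv k \<noteq> pv l"
    and inj_sv: "inj sv" and inj_pv: "inj pv"
    and E_sub: "\<And>k. k < m \<Longrightarrow> E k \<subseteq> X"
    and E_0: "E 0 = X"
    and two_le: "2 \<le> m"
    and adj_XX: "\<And>x y. x \<in> X \<Longrightarrow> y \<in> X \<Longrightarrow> adj G x y \<longleftrightarrow> x \<noteq> y"
    and adj_sX: "\<And>k x. k < m \<Longrightarrow> x \<in> X \<Longrightarrow> adj G (sv k) x \<longleftrightarrow> x \<in> E k"
    and adj_pX: "\<And>k x. k < m \<Longrightarrow> x \<in> X \<Longrightarrow> adj G (pv k) x"
    and adj_ss: "\<And>k l. k < m \<Longrightarrow> l < m \<Longrightarrow> \<not> adj G (sv k) (sv l)"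
    and adj_ps: "\<And>k l. k < m \<Longrightarrow> l < m \<Longrightarrow> adj G (pv k) (sv l) \<longleftrightarrow> k = l"
    and adj_pp: "\<And>k l. k < m \<Longrightarrow> l < m \<Longrightarrow> adj G (pv k) (pv l) \<longleftrightarrow> k \<noteq> l"
begin

abbreviation "A \<equiv> sv ` {..<m}"

lemma adj_sym: "adj G u v \<Longrightarrow> adj G v u"
  by (simp add: adj_def insert_commute)

lemma split_graph_gadget: "split_graph G"
  unfolding split_graph_def
proof (intro exI conjI)
  show "(X \<union> pv ` {..<m}) \<union> A = verts G" using verts_eq by auto
  show "(X \<union> pv ` {..<m}) \<inter> A = {}" using sv_notin sv_pv by (auto simp: eq_commute)
  show "clique G (X \<union> pv ` {..<m})"
    unfolding clique_def using verts_eq adj_XX adj_pX adj_pp adj_sym by auto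
  show "independent G A"
    unfolding independent_def using verts_eq adj_ss by auto
qed

section \<open>Labellings that come from hitting sets\<close>

definition lab :: "'a set \<Rightarrow> 'a \<Rightarrow> nat" where
  "lab D = (\<lambda>v\<in>verts G. if v \<in> A then 2 else if v \<in> D then 1 else 0)"

lemma lab_simps:
  "k < m \<Longrightarrow> lab D (sv k) = 2"
  "D \<subseteq> X \<Longrightarrow> k < m \<Longrightarrow> lab D (pv k) = 0"
  "x \<in> X \<Longrightarrow> lab D x = (if x \<in> D then 1 else 0)"
  using sv_notin pv_notin sv_pv inj_pv by (auto simp: lab_def verts_eq dest: sym)

lemma level_lab:
  assumes "D \<subseteq> X"
  shows "level G (lab D) 2 = A" "level G (lab D) 1 = D"
  using assms sv_notin by (auto simp: level_def lab_def verts_eq)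

lemma lab_inj: "D \<subseteq> X \<Longrightarrow> D' \<subseteq> X \<Longrightarrow> lab D = lab D' \<Longrightarrow> D = D'"
  using level_lab(2) by metis

text \<open>Elements outside \<open>D\<close> are dominated by \<open>sv 0\<close>, as
  \<open>E 0 = X\<close>, and each \<open>pv k\<close> by its own \<open>sv k\<close>. So domination
  alone does not force \<open>D\<close> to hit anything.\<close>

lemma rdf_lab:
  assumes "D \<subseteq> X"
  shows "rdf G (lab D)"
  unfolding rdf_def
proof (intro conjI ballI)
  show "lab D \<in> verts G \<rightarrow>\<^sub>E {0, 1, 2}" by (auto simp: lab_def)
  fix v assume v: "v \<in> level G (lab D) 0"
  then consider "v \<in> X" | k where "k < m" "v = pv k"
    by (auto simp: level_def verts_eq lab_simps)
  then show "\<exists>u\<in>level G (lab D) 2. adj G v u"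
  proof cases
    case 1
    then have "adj G v (sv 0)" using adj_sX[of 0 v] E_0 two_le adj_sym by auto
    then show ?thesis using two_le unfolding level_lab[OF assms] by force
  next
    case 2
    then show ?thesis using adj_ps unfolding level_lab[OF assms] by blast
  qed
qed

lemma adj_induced [simp]: "adj (induced G U) u v \<longleftrightarrow> adj G u v \<and> u \<in> U \<and> v \<in> U"
  by (auto simp: adj_def induced_def)

definition hits :: "'a set \<Rightarrow> bool" where "hits D \<longleftrightarrow> hitting_set X (E ` {..<m}) D"

lemma hits_iff: "hits D \<longleftrightarrow> D \<subseteq> X \<and> (\<forall>k<m. \<exists>d\<in>D. d \<in> E k)"
  unfolding hits_def hitting_set_def by auto

text \<open>Elements of \<open>D\<close> see \<open>sv 0\<close>; a vertex \<open>sv k\<close> sees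
  an element of \<open>D\<close> that hits \<open>E k\<close>.\<close>

lemma trdf_lab: assumes "hits D" shows "trdf G (lab D)"
proof -
  have D: "D \<subseteq> X" using assms hits_iff by blast
  show ?thesis unfolding trdf_def level_lab[OF D]
  proof (intro conjI rdf_lab[OF D] ballI)
    fix v assume "v \<in> D \<union> A"
    then show "\<exists>u\<in>D \<union> A. adj G v u"
    proof
      assume "v \<in> D"
      then have "adj G v (sv 0)" using adj_sX[of 0 v] E_0 two_le adj_sym D by auto
      then show ?thesis using two_le by force
    next
      assume "v \<in> A"
      then obtain k where k: "k < m" "v = sv k" by auto
      then obtain d where d: "d \<in> D" "d \<in> E k" using assms hits_iff by blast
      then have "adj G v d" using k adj_sX D by auto
      then show ?thesis using d by blast
    qed
  qed
qed

text \<open>\<open>D\<close> is a nonempty clique, and each \<open>sv k\<close> hangs on an element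
  of \<open>D\<close> that hits \<open>E k\<close>.\<close>

lemma crdf_lab: assumes "hits D" shows "crdf G (lab D)"
proof -
  have D: "D \<subseteq> X" using assms hits_iff by blast
  obtain d0 where d0: "d0 \<in> D" using assms two_le unfolding hits_iff by fastforce
  let ?H = "induced G (D \<union> A)"
  have DD: "(adj ?H)\<^sup>*\<^sup>* u v" if "u \<in> D" "v \<in> D" for u v
    using that adj_XX[of u v] subsetD[OF D] by (cases "u = v") (auto intro!: r_into_rtranclp)
  have to: "(adj ?H)\<^sup>*\<^sup>* v d0 \<and> (adj ?H)\<^sup>*\<^sup>* d0 v" if v: "v \<in> D \<union> A" for v
  proof (cases "v \<in> D")
    case True
    then show ?thesis using DD d0 by blast
  next
    case False
    then obtain k where k: "k < m" "v = sv k" using v by auto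
    then obtain d where d: "d \<in> D" "d \<in> E k" using assms hits_iff by blast
    then have "adj ?H v d" "adj ?H d v" using k adj_sX D v adj_sym by auto
    then show ?thesis using DD[OF d(1) d0] DD[OF d0 d(1)]
      by (meson converse_rtranclp_into_rtranclp rtranclp.rtrancl_into_rtrancl)
  qed
  have "connected_graph ?H" unfolding connected_graph_def
  proof (intro ballI)
    fix u v assume "u \<in> verts ?H" "v \<in> verts ?H"
    then have "u \<in> D \<union> A" "v \<in> D \<union> A" by (auto simp: induced_def)
    then show "(adj ?H)\<^sup>*\<^sup>* u v" using to by (meson rtranclp_trans)
  qed
  then show ?thesis unfolding crdf_def level_lab[OF D] using rdf_lab[OF D] by simp
qed

text \<open>A path from \<open>sv k\<close> to another vertex \<open>sv l\<close> must leave
  \<open>sv k\<close> through a vertex of positive value.\<close>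

lemma crdf_neighbour:
  assumes "crdf G f" "level G f 2 = A" "k < m"
  shows "\<exists>u\<in>level G f 1 \<union> level G f 2. adj G (sv k) u"
proof -
  let ?U = "level G f 1 \<union> level G f 2"
  define l where "l = (if k = 0 then 1 else 0 :: nat)"
  have l: "l < m" "l \<noteq> k" using two_le by (auto simp: l_def)
  have "sv k \<in> verts (induced G ?U)" "sv l \<in> verts (induced G ?U)"
    using assms l verts_eq by (auto simp: induced_def)
  then have "(adj (induced G ?U))\<^sup>*\<^sup>* (sv k) (sv l)"
    using assms(1) unfolding crdf_def connected_graph_def by blast
  then show ?thesis
  proof (cases rule: converse_rtranclpE)
    case base
    then show ?thesis using l inj_sv by (simp add: inj_eq)
  next
    case (step u)
    then show ?thesis by auto
  qed
qed

text \<open>Connectedness and totality enter only through these four properties, so one argument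
  covers both classes. By \<open>P_change\<close>, once domination is given, \<open>P\<close>
  depends on the support alone; this permits lowering a 2 to a 1.\<close>

lemma minimal_iff:
  assumes P_rdf: "\<And>f. P G f \<Longrightarrow> rdf G f"
    and P_lab: "\<And>D. hits D \<Longrightarrow> P G (lab D)"
    and P_nb: "\<And>f k. P G f \<Longrightarrow> level G f 2 = A \<Longrightarrow> k < m \<Longrightarrow>
        \<exists>u\<in>level G f 1 \<union> level G f 2. adj G (sv k) u"
    and P_change: "\<And>f g. P G f \<Longrightarrow> rdf G g \<Longrightarrow>
        level G g 1 \<union> level G g 2 = level G f 1 \<union> level G f 2 \<Longrightarrow> P G g"
  shows "{f. minimal_in G P f \<and> level G f 2 = A} = lab ` minimal_hitting_sets X (E ` {..<m})"
proof -
  have hitsD: "hits (level G f 1 \<inter> X)" if f: "P G f" "level G f 2 = A"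
    and p0: "\<And>k. 0 < k \<Longrightarrow> k < m \<Longrightarrow> f (pv k) = 0" for f
  proof -
    have pos: "\<exists>d\<in>level G f 1 \<inter> X. d \<in> E k" if k: "0 < k" "k < m" for k
    proof -
      obtain u where u: "u \<in> level G f 1 \<union> level G f 2" "adj G (sv k) u"
        using P_nb f k by blast
      \<comment> \<open>The neighbour of positive value is not in the independent set
        \<open>A\<close>, and the only \<open>pv l\<close> adjacent to \<open>sv k\<close> is
        \<open>pv k\<close>, whose value is 0. So it is an element.\<close>
      have "u \<notin> A" using u k adj_ss by auto
      then have u1: "u \<in> level G f 1" using u f by blast
      then consider "u \<in> X" | l where "l < m" "u = pv l"
        using \<open>u \<notin> A\<close> unfolding level_def verts_eq by auto
      then show ?thesis
      proof cases
        case 1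
        then show ?thesis using u1 u adj_sX k by blast
      next
        case 2
        then have "l = k" using u k adj_ps adj_sym by blast
        then show ?thesis using 2 p0 k u1 by (simp add: level_def)
      qed
    qed
    \<comment> \<open>For \<open>k = 0\<close> the value of \<open>pv 0\<close> is not known yet,
      since lowering \<open>sv 0\<close> would endanger the domination of \<open>X\<close>. But
      whatever hits \<open>E 1\<close> also hits \<open>E 0 = X\<close>.\<close>
    have "\<exists>d\<in>level G f 1 \<inter> X. d \<in> E k" if "k < m" for k
      using pos[of k] pos[of 1] that two_le E_0 by (cases "k = 0") auto
    then show ?thesis unfolding hits_iff by blast
  qed
  have forced: "f = lab (level G f 1 \<inter> X) \<and> hits (level G f 1 \<inter> X)"
    if f: "minimal_in G P f" "level G f 2 = A" for f
  proof -
    have Pf: "P G f" and min: "\<And>g. P G g \<Longrightarrow> le_on G g f \<Longrightarrow> g = f"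
      using f unfolding minimal_in_def by auto
    have rf: "rdf G f" using P_rdf Pf .
    have fs: "f (sv k) = 2" if "k < m" for k using f(2) that unfolding level_def by blast
    have "f (pv k) = 0" if k: "0 < k" "k < m" for k
    proof (rule ccontr)
      assume n0: "f (pv k) \<noteq> 0"
      \<comment> \<open>Lowering \<open>sv k\<close> to 1 keeps the support and, as \<open>sv 0\<close> dominates \<open>X\<close>, the domination.\<close>
      let ?g = "f(sv k := 1)"
      have svk: "sv k \<in> verts G" using k verts_eq by auto
      have "rdf G ?g" unfolding rdf_def
      proof (intro conjI ballI)
        show "?g \<in> verts G \<rightarrow>\<^sub>E {0, 1, 2}" using rf svk unfolding rdf_def
          by (auto simp: PiE_iff extensional_def)
        fix v assume "v \<in> level G ?g 0"
        then have v: "v \<in> verts G" "f v = 0" "v \<noteq> sv k" by (auto simp: level_def split: if_splits)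
        have in2: "sv l \<in> level G ?g 2" if "l < m" "l \<noteq> k" for l
          using that fs verts_eq inj_sv by (auto simp: level_def inj_eq)
        from v fs consider "v \<in> X" | l where "l < m" "v = pv l"
          unfolding verts_eq by fastforce
        then show "\<exists>u\<in>level G ?g 2. adj G v u"
        proof cases
          case 1
          then have "adj G v (sv 0)" using adj_sX[of 0 v] E_0 k adj_sym by auto
          then show ?thesis using in2[of 0] k by auto
        next
          case 2
          then have "l \<noteq> k" using v n0 by auto
          then show ?thesis using in2[of l] 2 adj_ps by auto
        qed
      qed
      moreover have "level G ?g 1 \<union> level G ?g 2 = level G f 1 \<union> level G f 2"
        using fs[OF k(2)] svk by (auto simp: level_def)
      ultimately have "P G ?g" using P_change Pf by blast
      moreover have "le_on G ?g f" using fs[OF k(2)] by (auto simp: le_on_def)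
      ultimately have "?g = f" by (rule min)
      then have "?g (sv k) = f (sv k)" by simp
      then show False using fs k by simp
    qed
    then have h: "hits (level G f 1 \<inter> X)" using hitsD Pf f by blast
    \<comment> \<open>This labelling lies below \<open>f\<close> and satisfies \<open>P\<close>, so
      minimality makes it equal to \<open>f\<close>; that also settles the value of
      \<open>pv 0\<close>.\<close>
    have "le_on G (lab (level G f 1 \<inter> X)) f"
      using fs by (auto simp: le_on_def lab_def level_def)
    then show ?thesis using h min P_lab by metis
  qed
  have lab_le: "le_on G (lab D') (lab D)" if "D' \<subseteq> D" for D D'
    using that by (auto simp: le_on_def lab_def)
  have lab_min: "g = lab D"
    if D: "hits D" and Dmin: "\<And>D'. hits D' \<Longrightarrow> D' \<subseteq> D \<Longrightarrow> D' = D"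
      and g: "P G g" "le_on G g (lab D)" for D g
  proof -
    have DX: "D \<subseteq> X" using D hits_iff by blast
    have rg: "rdf G g" using P_rdf g by blast
    have le: "v \<in> verts G \<Longrightarrow> g v \<le> lab D v" for v using g by (auto simp: le_on_def)
    have gp: "g (pv k) = 0" if "k < m" for k
      using le[of "pv k"] that lab_simps(2)[OF DX that] verts_eq by auto
    have sub2: "level G g 2 \<subseteq> A"
    proof
      fix v assume "v \<in> level G g 2"
      then have v: "v \<in> verts G" "2 \<le> lab D v" using le[of v] by (auto simp: level_def)
      then show "v \<in> A" by (auto simp: lab_def split: if_splits)
    qed
    \<comment> \<open>The private neighbour \<open>pv k\<close> has value 0 and its only neighbour
      in \<open>A\<close> is \<open>sv k\<close>. As \<open>level G g 2\<close> lies inside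
      \<open>A\<close>, the value of \<open>sv k\<close> must stay 2.\<close>
    have "sv k \<in> level G g 2" if k: "k < m" for k
    proof -
      have "pv k \<in> level G g 0" using gp k verts_eq by (auto simp: level_def)
      then obtain u where u: "u \<in> level G g 2" "adj G (pv k) u" using rg unfolding rdf_def by blast
      then obtain l where "l < m" "u = sv l" using sub2 by blast
      then show ?thesis using u adj_ps k by blast
    qed
    then have g2: "level G g 2 = A" using sub2 by blast
    have h: "hits (level G g 1 \<inter> X)" using hitsD g g2 gp by blast
    have "level G g 1 \<inter> X \<subseteq> D"
    proof
      fix v assume v: "v \<in> level G g 1 \<inter> X"
      then have "1 \<le> lab D v" using le[of v] by (auto simp: level_def)
      then show "v \<in> D" using lab_simps(3)[of v D] v by (auto split: if_splits)
    qed
    then have eq: "level G g 1 \<inter> X = D" using Dmin h by blast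
    show ?thesis
    proof (rule extensionalityI[of _ "verts G"])
      show "g \<in> extensional (verts G)" using rg unfolding rdf_def by (auto simp: PiE_iff)
      show "lab D \<in> extensional (verts G)" by (simp add: lab_def)
      fix v assume v: "v \<in> verts G"
      then consider "v \<in> X" | k where "k < m" "v = sv k" | k where "k < m" "v = pv k"
        unfolding verts_eq by auto
      then show "g v = lab D v"
      proof cases
        case 1
        have "g v \<le> 1" using le[OF v] lab_simps(3)[OF 1, of D] by (auto split: if_splits)
        moreover have "g v = 1 \<longleftrightarrow> v \<in> D" using eq v 1 unfolding level_def by auto
        ultimately show ?thesis using lab_simps(3)[OF 1, of D] by auto
      next
        case 2
        then have "v \<in> level G g 2" using g2 by blast
        then show ?thesis using lab_simps(1) 2 by (simp add: level_def)
      next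
        case 3
        then show ?thesis using gp lab_simps(2)[OF DX] by simp
      qed
    qed
  qed
  have mhs: "D \<in> minimal_hitting_sets X (E ` {..<m}) \<longleftrightarrow>
      hits D \<and> (\<forall>D'. hits D' \<and> D' \<subseteq> D \<longrightarrow> D' = D)" for D
    by (simp add: minimal_hitting_sets_def hits_def)
  show ?thesis
  proof (intro set_eqI iffI)
    fix f assume "f \<in> {f. minimal_in G P f \<and> level G f 2 = A}"
    then have f: "minimal_in G P f" "level G f 2 = A" by auto
    define D where "D = level G f 1 \<inter> X"
    have D: "f = lab D" "hits D" using forced[OF f] unfolding D_def by auto
    have "D' = D" if "hits D'" "D' \<subseteq> D" for D'
    proof -
      have "lab D' = lab D"
        using f(1) P_lab[OF that(1)] lab_le[OF that(2)] D(1) unfolding minimal_in_def by blast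
      then show ?thesis using lab_inj that D(2) unfolding hits_iff by blast
    qed
    then show "f \<in> lab ` minimal_hitting_sets X (E ` {..<m})" using D mhs by blast
  next
    fix f assume "f \<in> lab ` minimal_hitting_sets X (E ` {..<m})"
    then obtain D where D: "f = lab D" "hits D" "\<And>D'. hits D' \<Longrightarrow> D' \<subseteq> D \<Longrightarrow> D' = D"
      using mhs by blast
    then have "minimal_in G P f" unfolding minimal_in_def using P_lab lab_min by blast
    moreover have "level G f 2 = A" using D(1,2) level_lab(1)[of D] unfolding hits_iff by simp
    ultimately show "f \<in> {f. minimal_in G P f \<and> level G f 2 = A}" by blast
  qed
qed

lemma C_CRDF_eq: "C_CRDF G A = lab ` minimal_hitting_sets X (E ` {..<m})"
  unfolding C_CRDF_def
proof (rule minimal_iff)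
  show "crdf G (lab D)" if "hits D" for D using that by (rule crdf_lab)
  show "\<exists>u\<in>level G f 1 \<union> level G f 2. adj G (sv k) u"
    if "crdf G f" "level G f 2 = A" "k < m" for f k using that by (rule crdf_neighbour)
qed (simp_all add: crdf_def)

lemma C_TRDF_eq: "C_TRDF G A = lab ` minimal_hitting_sets X (E ` {..<m})"
  unfolding C_TRDF_def
proof (rule minimal_iff)
  show "trdf G (lab D)" if "hits D" for D using that by (rule trdf_lab)
  show "trdf G g" if "trdf G f" "rdf G g"
    "level G g 1 \<union> level G g 2 = level G f 1 \<union> level G f 2" for f g
    using that unfolding trdf_def by simp
  show "\<exists>u\<in>level G f 1 \<union> level G f 2. adj G (sv k) u"
    if "trdf G f" "level G f 2 = A" "k < m" for f k using that unfolding trdf_def by blast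
qed (simp add: trdf_def)

end

section \<open>Correctness of the reduction\<close>

text \<open>Elements are the vertices below \<open>n\<close>; hyperedge \<open>k\<close> owns the consecutive vertices
  \<open>n + 2 * k\<close> (labelled 2) and \<open>n + 2 * k + 1\<close> (its private neighbour). With this numbering
  the rows of the adjacency matrix can be written in one pass over the hyperedges, and in an
  encoded solution the element labels are exactly the symbols before the first \<open>S2\<close>.
  \<open>below\<close> is only meaningful for \<open>j < i\<close>.\<close>

definition below :: "nat \<Rightarrow> nat set list \<Rightarrow> nat \<Rightarrow> nat \<Rightarrow> bool" where
  "below n es i j \<longleftrightarrow> (if i < n then True
     else if even (i - n) then j < n \<and> j \<in> es ! ((i - n) div 2)
     else j < n \<or> odd (j - n) \<or> Suc j = i)"

definition red_graph :: "nat \<Rightarrow> nat set list \<Rightarrow> nat ugraph" where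
  "red_graph n es = \<lparr>verts = {..<n + 2 * length es},
     edges = {{i, j} | i j. j < i \<and> i < n + 2 * length es \<and> below n es i j}\<rparr>"

definition red_set :: "nat \<Rightarrow> nat set list \<Rightarrow> nat set" where
  "red_set n es = (\<lambda>k. n + 2 * k) ` {..<length es}"

lemma verts_red_graph [simp]: "verts (red_graph n es) = {..<n + 2 * length es}"
  by (simp add: red_graph_def)

lemma adj_red_graph:
  "adj (red_graph n es) i j \<longleftrightarrow>
     (j < i \<and> i < n + 2 * length es \<and> below n es i j) \<or>
     (i < j \<and> j < n + 2 * length es \<and> below n es j i)"
  by (auto simp: adj_def red_graph_def doubleton_eq_iff)

lemma simple_red_graph: "simple_graph (red_graph n es)"
  unfolding simple_graph_def
proof
  show "edges (red_graph n es) \<subseteq>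
      {{u, v} |u v. u \<in> verts (red_graph n es) \<and> v \<in> verts (red_graph n es) \<and> u \<noteq> v}"
  proof
    fix e assume "e \<in> edges (red_graph n es)"
    then obtain i j where "e = {i, j}" "j < i" "i < n + 2 * length es"
      by (auto simp: red_graph_def)
    then show "e \<in> {{u, v} |u v. u \<in> verts (red_graph n es) \<and> v \<in> verts (red_graph n es) \<and> u \<noteq> v}"
      by (intro CollectI exI[of _ i] exI[of _ j]) auto
  qed
qed simp

lemma gadget_red_graph:
  assumes "\<And>e. e \<in> set es \<Longrightarrow> e \<subseteq> {..<n}" "es ! 0 = {..<n}" "2 \<le> length es"
  shows "gadget (red_graph n es) {..<n} (length es) ((!) es) (\<lambda>k. n + 2 * k) (\<lambda>k. n + 2 * k + 1)"
proof -
  let ?G = "red_graph n es"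
  have "v < n \<or> v \<in> (\<lambda>k. n + 2 * k) ` {..<length es} \<or> v \<in> (\<lambda>k. n + 2 * k + 1) ` {..<length es}"
    if v: "v < n + 2 * length es" for v
  proof -
    \<comment> \<open>Beyond the elements, the quotient by 2 is the index of the owning hyperedge,
      and the parity tells its vertex from the private neighbour.\<close>
    have "v < n \<or> v = n + 2 * ((v - n) div 2) \<or> v = n + 2 * ((v - n) div 2) + 1" by presburger
    moreover have "(v - n) div 2 < length es" if "n \<le> v" using v that by auto
    ultimately show ?thesis using leI by blast
  qed
  then have verts: "verts ?G = {..<n} \<union> (\<lambda>k. n + 2 * k) ` {..<length es} \<union>
      (\<lambda>k. n + 2 * k + 1) ` {..<length es}" by auto
  have parity: "n + 2 * k \<noteq> n + 2 * l + 1" for k l by presburger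
  have ss: "\<not> adj ?G (n + 2 * k) (n + 2 * l)" for k l
    by (auto simp: adj_red_graph below_def)
  have ps: "adj ?G (n + 2 * k + 1) (n + 2 * l) \<longleftrightarrow> k = l"
    if "k < length es" "l < length es" for k l
    using that by (auto simp: adj_red_graph below_def)
  have pp: "adj ?G (n + 2 * k + 1) (n + 2 * l + 1) \<longleftrightarrow> k \<noteq> l"
    if "k < length es" "l < length es" for k l
    using that by (auto simp: adj_red_graph below_def)
  have XX: "adj ?G x y \<longleftrightarrow> x \<noteq> y" if "x < n" "y < n" for x y
    using that by (auto simp: adj_red_graph below_def)
  have sX: "adj ?G (n + 2 * k) x \<longleftrightarrow> x \<in> es ! k" and pX: "adj ?G (n + 2 * k + 1) x"
    if "k < length es" "x < n" for k x
    using that by (auto simp: adj_red_graph below_def)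
  show ?thesis
    using assms verts parity ss ps pp XX sX pX
    by unfold_locales (simp_all add: inj_def)
qed

section \<open>Encodings of the reduced instance and of its solutions\<close>

lemma upt_pairs: "[0..<n + 2 * m] = [0..<n] @ concat (map (\<lambda>k. [n + 2 * k, n + 2 * k + 1]) [0..<m])"
  by (induction m) auto

lemma concat_const: "concat (map (\<lambda>_. w) [0..<m]) = concat (replicate m w)"
  by (simp add: map_replicate_const)

lemma concat_map_concat_map: "concat (map f (concat (map g xs))) = concat (map (\<lambda>x. concat (map f (g x))) xs)"
  by (induction xs) auto

lemma bits_clique_row:
  "i < n \<Longrightarrow> bits i {j. adj (red_graph n es) i j} = ones i @ [Sep]"
  by (rule nth_equalityI) (auto simp: bits_def adj_red_graph below_def nth_append)

lemma bits_gadget_rows: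
  assumes k: "k < length es"
  shows "bits (n + 2 * k) {j. adj (red_graph n es) (n + 2 * k) j} @
      bits (n + 2 * k + 1) {j. adj (red_graph n es) (n + 2 * k + 1) j} = gadget_rows n (es ! k) k"
proof -
  have "bits (n + 2 * k) {j. adj (red_graph n es) (n + 2 * k) j} =
      map (\<lambda>i. if i \<in> es ! k then S1 else S0) [0..<n] @
      concat (map (\<lambda>_. [S0, S0]) [0..<k]) @ [Sep]"
    unfolding bits_def upt_pairs map_append map_concat map_map using k
    by (auto simp: adj_red_graph below_def comp_def intro!: arg_cong[where f = concat])
  moreover have "bits (n + 2 * k + 1) {j. adj (red_graph n es) (n + 2 * k + 1) j} =
      map (\<lambda>_. S1) [0..<n] @ concat (map (\<lambda>_. [S0, S1]) [0..<k]) @ [S1, Sep]"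
  proof -
    have "[0..<n + 2 * k + 1] = [0..<n + 2 * k] @ [n + 2 * k]" by simp
    then show ?thesis
      unfolding bits_def upt_pairs map_append map_concat map_map using k
      by (auto simp: adj_red_graph below_def comp_def upt_pairs map_concat
          intro!: arg_cong[where f = concat])
  qed
  ultimately show ?thesis
    by (simp add: gadget_rows_def concat_const map_replicate_const)
qed

text \<open>Links the output of the program to the prescribed encoding: the vertex range is cut into
  the elements and the consecutive pairs, in the order in which the program writes the rows.\<close>

lemma encode_red_graph: "encode_graph_set (red_graph n es, red_set n es) = graph_code n es"
proof -
  let ?G = "red_graph n es" and ?m = "length es"
  let ?row = "\<lambda>i. bits i {j. adj ?G i j}"
  have "encode_graph ?G = concat (map ?row [0..<n]) @
      concat (map (\<lambda>k. ?row (n + 2 * k) @ ?row (n + 2 * k + 1)) [0..<?m])"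
    unfolding encode_graph_def verts_red_graph card_lessThan upt_pairs
    by (simp add: concat_map_concat_map del: upt_Suc)
  also have "concat (map ?row [0..<n]) = clique_rows n"
    unfolding clique_rows_def by (intro arg_cong[where f = concat] map_cong) (auto simp: bits_clique_row)
  also have "concat (map (\<lambda>k. ?row (n + 2 * k) @ ?row (n + 2 * k + 1)) [0..<?m]) =
      concat (map (\<lambda>k. gadget_rows n (es ! k) k) [0..<?m])"
    using bits_gadget_rows[of _ es n] by (intro arg_cong[where f = concat] map_cong) auto
  finally have "encode_graph ?G = clique_rows n @ concat (map (\<lambda>k. gadget_rows n (es ! k) k) [0..<?m])" .
  moreover have "bits (n + 2 * ?m) (red_set n es) =
      map (\<lambda>_. S0) [0..<n] @ concat (map (\<lambda>_. [S1, S0]) [0..<?m]) @ [Sep]"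
  proof -
    have odd: "n + 2 * k + 1 \<notin> red_set n es" for k unfolding red_set_def by (auto, presburger)
    have even: "n + 2 * k \<in> red_set n es" if "k < ?m" for k using that unfolding red_set_def by auto
    have low: "i \<notin> red_set n es" if "i < n" for i using that unfolding red_set_def by auto
    show ?thesis
      unfolding bits_def upt_pairs map_append map_concat map_map using odd even low
      by (auto simp: comp_def intro!: arg_cong[where f = concat])
  qed
  ultimately show ?thesis
    by (simp add: encode_graph_set_def graph_code_def concat_const map_replicate_const)
qed

text \<open>Row \<open>i\<close> has \<open>i\<close> bits and a separator, and the row of
  \<open>A\<close> has one bit per vertex and a separator, so the length is a triangular sum plus
  one full row.\<close>

lemma length_graph_code: "length (graph_code n es) \<le> (n + 2 * length es + 1)\<^sup>2"
proof -
  let ?N = "n + 2 * length es"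
  have "length (graph_code n es) = (\<Sum>i<?N. i + 1) + (?N + 1)"
    unfolding encode_red_graph[symmetric] encode_graph_set_def encode_graph_def
    by (simp add: bits_def length_concat comp_def interv_sum_list_conv_sum_set_nat atLeast0LessThan)
  also have "(\<Sum>i<?N. i + 1) \<le> (\<Sum>i<?N. ?N)" by (intro sum_mono) simp
  finally show ?thesis by (simp add: power2_eq_square algebra_simps)
qed

definition red_lab :: "nat \<Rightarrow> nat set list \<Rightarrow> nat set \<Rightarrow> nat \<Rightarrow> nat" where
  "red_lab n es = gadget.lab (red_graph n es) (length es) (\<lambda>k. n + 2 * k)"

text \<open>All that depends on \<open>D\<close> stands before the first \<open>S2\<close>, so
  cutting there recovers the hitting set.\<close>

lemma encode_red_lab:
  assumes "gadget (red_graph n es) {..<n} (length es) ((!) es) (\<lambda>k. n + 2 * k) (\<lambda>k. n + 2 * k + 1)"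
    and D: "D \<subseteq> {..<n}"
  shows "encode_labelling (red_graph n es, A) (red_lab n es D) =
    map (\<lambda>i. if i \<in> D then S1 else S0) [0..<n] @ concat (replicate (length es) [S2, S0]) @ [Sep]"
proof -
  interpret gadget "red_graph n es" "{..<n}" "length es" "(!) es" "\<lambda>k. n + 2 * k" "\<lambda>k. n + 2 * k + 1"
    by fact
  let ?f = "\<lambda>v. if lab D v = 0 then S0 else if lab D v = 1 then S1 else S2"
  have "map ?f [0..<n + 2 * length es] =
    map (\<lambda>i. if i \<in> D then S1 else S0) [0..<n] @ concat (map (\<lambda>_. [S2, S0]) [0..<length es])"
    unfolding upt_pairs map_append map_concat map_map using lab_simps(1) lab_simps(2)[OF D] lab_simps(3)
    by (auto simp: comp_def intro!: arg_cong[where f = concat])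
  then show ?thesis by (simp add: encode_labelling_def red_lab_def concat_const)
qed

text \<open>A point that hits some hyperedge lies in \<open>X\<close>, so it hits \<open>X\<close>
  too; this takes at least one hyperedge.\<close>

lemma minimal_hitting_sets_insert_ground:
  assumes "S \<noteq> {}" "\<And>e. e \<in> S \<Longrightarrow> e \<subseteq> X"
  shows "minimal_hitting_sets X (insert X S) = minimal_hitting_sets X S"
proof -
  obtain e where "e \<in> S" using assms(1) by blast
  then have "D \<inter> X \<noteq> {}" if "hitting_set X S D" for D
    using that assms(2)[of e] unfolding hitting_set_def by blast
  then have "hitting_set X (insert X S) D \<longleftrightarrow> hitting_set X S D" for D
    unfolding hitting_set_def by auto
  then show ?thesis by (simp add: minimal_hitting_sets_def)
qed

section \<open>Composition of the programs and the polynomial time bound\<close>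

lemma poly_nat_mono: "a \<le> b \<Longrightarrow> poly p a \<le> poly (p :: nat poly) b"
proof (induction p)
  case (pCons c p)
  then have "a * poly p a \<le> b * poly p b" by (intro mult_le_mono) auto
  then show ?case by simp
qed simp

text \<open>The two problems share instances and encodings and differ only in their solution sets,
  which \<open>sol\<close> ties to minimal hitting sets. The combined program and its time analysis
  thus serve both.\<close>

lemma output_polynomial_Enum_TrI:
  fixes P :: "(nat ugraph \<times> nat set, nat \<Rightarrow> nat) enum_problem"
  assumes "output_polynomial P"
    and inst: "instances P = graph_set_instances split_graph"
    and enc: "encode P = encode_graph_set"
    and enc_sol: "encode_sol P = encode_labelling"
    and sol: "\<And>n es. gadget (red_graph n es) {..<n} (length es) ((!) es)
        (\<lambda>k. n + 2 * k) (\<lambda>k. n + 2 * k + 1) \<Longrightarrow>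
      solutions P (red_graph n es, red_set n es) = red_lab n es ` minimal_hitting_sets {..<n} (set es)"
  shows "output_polynomial Enum_Tr"
proof -
  obtain c p where cp: "\<And>x. x \<in> instances P \<Longrightarrow> \<exists>t s ys. exec c (init_store (encode P x)) t s \<and>
      distinct ys \<and> set ys = solutions P x \<and> s 1 = concat (map (encode_sol P x) ys) \<and>
      t \<le> poly p (length (encode P x) + card (solutions P x))"
    using assms(1) unfolding output_polynomial_def by blast
  obtain k where k: "k \<notin> written_stacks c \<union> {0, 1}"
    using ex_new_if_finite[of "written_stacks c \<union> {0, 1}"] finite_written_stacks by auto
  let ?prog = "Seq read_size (IfTop 0 {None} empty_answer
      (Seq write_graph (Seq c (truncate_answers k))))"
  \<comment> \<open>With \<open>B\<close> the input length plus the number of outputs, the new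
    instance has encoded length at most \<open>(3 * B + 1)\<^sup>2\<close>; adding at most
    \<open>B\<close> solutions gives the argument of \<open>p\<close>. The second summand generously
    covers the reduction and the post-processing.\<close>
  let ?q = "pcompose p [:1, 7, 9:] + [:30, 200, 300:]"
  have main: "\<exists>T s ys. runs ?prog (init_store w) T s \<and> distinct ys \<and>
      set ys = minimal_hitting_sets {..<n} (set es) \<and> s 1 = concat (map (bits n) ys) \<and>
      T \<le> poly ?q (length w + card (minimal_hitting_sets {..<n} (set es)))"
    if es: "\<And>e. e \<in> set es \<Longrightarrow> e \<subseteq> {..<n}"
      and w: "w = ones n @ Sep # concat (map (bits n) es)" for n es w
  proof -
    define B where "B = length w + card (minimal_hitting_sets {..<n} (set es))"
    have "length (concat (map (bits n) es)) = length es * (n + 1)"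
      by (induction es) (auto simp: bits_def)
    then have nm: "n + 1 \<le> B" "length es + 1 \<le> B" "length w \<le> B"
      unfolding B_def w by auto
    have read: "runs read_size (init_store w) (11 * n + 2)
        (store6 (concat (map (bits n) es)) [] (ones n) [] [] [])"
      using runs_read_size[of n "concat (map (bits n) es)"]
      by (simp add: w init_store_eq)
    show ?thesis
    proof (cases "es = []")
      case True
      \<comment> \<open>Here the ground set, added as a hyperedge, would not be hit automatically, so the
        program answers directly.\<close>
      let ?s = "store6 [] (replicate n S0 @ [Sep]) [] [] [] []"
      have "runs read_size (init_store w) (11 * n + 2) (store6 [] [] (ones n) [] [] [])"
        using read True by simp
      then have "runs ?prog (init_store w) (11 * n + 2 + (11 * n + 2 + 1)) ?s"
        by (rule runs_Seq[OF _ runs_IfTrue[OF _ runs_empty_answer]]) simp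
      moreover have "minimal_hitting_sets {..<n} (set es) = {{}}"
        unfolding True by (auto simp: minimal_hitting_sets_def hitting_set_def)
      moreover have "?s 1 = concat (map (bits n) [{}])"
        by (simp add: bits_def map_replicate_const)
      moreover have "11 * n + 2 + (11 * n + 2 + 1) \<le> poly ?q B"
        using nm(1) by (simp add: algebra_simps)
      ultimately show ?thesis unfolding B_def[symmetric]
        by (intro exI[of _ "11 * n + 2 + (11 * n + 2 + 1)"] exI[of _ ?s] exI[of _ "[{}]"]) simp
    next
      case False
      define es' where "es' = {..<n} # es"
      define m where "m = length es'"
      define M where "M = minimal_hitting_sets {..<n} (set es)"
      let ?x = "(red_graph n es', red_set n es')"
      have gad: "gadget (red_graph n es') {..<n} (length es') ((!) es')
          (\<lambda>k. n + 2 * k) (\<lambda>k. n + 2 * k + 1)"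
        using es False by (intro gadget_red_graph) (auto simp: es'_def Suc_le_eq)
      interpret g: gadget "red_graph n es'" "{..<n}" "length es'" "(!) es'"
        "\<lambda>k. n + 2 * k" "\<lambda>k. n + 2 * k + 1" by (rule gad)
      have "M = minimal_hitting_sets {..<n} (set es')"
        using minimal_hitting_sets_insert_ground[of "set es" "{..<n}"] es False
        by (simp add: M_def es'_def)
      then have sols: "solutions P ?x = red_lab n es' ` M" using sol[OF gad] by simp
      have MX: "D \<subseteq> {..<n}" if "D \<in> M" for D
        using that unfolding M_def minimal_hitting_sets_def hitting_set_def by blast
      have "?x \<in> instances P"
        using simple_red_graph g.split_graph_gadget
        by (auto simp: inst graph_set_instances_def red_set_def)
      then obtain t s ys where ex: "exec c (init_store (graph_code n es')) t s"
        and ys: "distinct ys" "set ys = red_lab n es' ` M"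
        and s1: "s 1 = concat (map (encode_labelling ?x) ys)"
        and t: "t \<le> poly p (length (graph_code n es') + card (red_lab n es' ` M))"
        using cp[of ?x] unfolding enc enc_sol encode_red_graph sols by blast
      \<comment> \<open>\<open>h\<close> reads the hitting set off a labelling. As it inverts
        \<open>red_lab\<close> on \<open>M\<close>, it turns \<open>ys\<close> into a
        repetition-free list of \<open>M\<close>; in particular both instances have equally many
        solutions.\<close>
      define h where "h f = {v. v < n \<and> f v = (1::nat)}" for f
      have h: "h (red_lab n es' D) = D" if "D \<in> M" for D
        using MX[OF that] g.lab_simps(3)[of _ D] unfolding h_def red_lab_def by (auto split: if_splits)
      define Ds where "Ds = map h ys"
      have setDs: "set Ds = M" unfolding Ds_def set_map ys(2) image_image using h by auto
      have ysDs: "ys = map (red_lab n es') Ds"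
        unfolding Ds_def map_map using h ys(2) by (intro map_idI[symmetric]) auto
      have dist: "distinct Ds" using ys(1) unfolding ysDs distinct_map by blast
      have card: "card M = length Ds" "card (red_lab n es' ` M) = length Ds"
        using distinct_card[OF dist] distinct_card[OF ys(1)] setDs ys(2) by (auto simp: Ds_def)
      \<comment> \<open>\<open>r\<close> is what follows the first \<open>S2\<close>, which exists
        since \<open>m\<close> is positive; it is the same for all answers.\<close>
      define r where "r = S0 # concat (replicate (m - 1) [S2, S0])"
      have m1: "m = Suc (m - 1)" by (simp add: m_def es'_def)
      have r: "concat (replicate m [S2, S0]) = S2 # r" unfolding r_def by (subst m1) simp
      have lr: "length r \<le> 2 * m" "set r \<subseteq> {S0, S1, S2}"
        unfolding r_def using m1 by (auto simp: length_concat sum_list_replicate)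
      have s1': "s 1 = concat (map (\<lambda>D. map (\<lambda>i. if i \<in> D then S1 else S0) [0..<n] @ S2 # r @ [Sep]) Ds)"
        unfolding s1 ysDs map_map
        using encode_red_lab[OF gad MX] setDs
        by (intro arg_cong[where f = concat] map_cong) (auto simp: r m_def[symmetric])
      have sk: "s k = []"
        using exec_unwritten_stack[OF ex, of k] k by (simp add: init_store_def)
      obtain s' where post: "runs (truncate_answers k) s
          (length Ds * (22 * n + 11 * length r + 27) + 2) s'" "s' 1 = concat (map (bits n) Ds)"
        using runs_truncate_answers[OF _ sk s1' lr(2)] k by auto
      let ?L = "length (graph_code n es')"
      let ?T = "11 * n + 2 + ((n * (22 * n + 6) + m * (33 * n + 44 * m + 14) + 22 * n + 11 * m
         + 11 * ?L + 8) + (t + (length Ds * (22 * n + 11 * length r + 27) + 2)) + 1)"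
      \<comment> \<open>Even for \<open>n = 0\<close> a hyperedge contributes its separator, so an
        empty stack 0 after \<open>read_size\<close> really means that there are no
        hyperedges.\<close>
      have "peek (concat (map (bits n) es)) \<noteq> None"
        using False by (cases es; cases n) (auto simp: bits_def peek_def upt_conv_Cons simp del: upt_Suc)
      moreover have "runs c (init_store (graph_code n es')) t s" using ex by (auto simp: runs_def)
      ultimately have run: "runs ?prog (init_store w) ?T s'"
        using runs_write_graph[of n es, folded es'_def, folded m_def]
        by (intro runs_Seq[OF read] runs_IfFalse runs_Seq[OF _ runs_Seq[OF _ post(1)]]) auto
      have mB: "n \<le> B" "m \<le> B" "length Ds \<le> B"
        using nm card(1) by (auto simp: m_def es'_def B_def M_def)
      have "?L \<le> (n + 2 * m + 1)\<^sup>2" unfolding m_def by (rule length_graph_code)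
      also have "\<dots> \<le> (3 * B + 1)\<^sup>2" using mB by (intro power_mono) auto
      finally have L: "?L \<le> (3 * B + 1)\<^sup>2" .
      have "t \<le> poly p ((3 * B + 1)\<^sup>2 + B)"
        using t card(2) L mB(3) poly_nat_mono[of "?L + length Ds" "(3 * B + 1)\<^sup>2 + B" p] by simp
      then have t': "t \<le> poly p (1 + B * (7 + B * 9))"
        by (simp add: power2_eq_square algebra_simps)
      have "?T \<le> 11 * B + 2 + ((B * (22 * B + 6) + B * (33 * B + 44 * B + 14) + 22 * B + 11 * B
         + 11 * (3 * B + 1)\<^sup>2 + 8) + (poly p (1 + B * (7 + B * 9)) + (B * (22 * B + 11 * (2 * B) + 27) + 2)) + 1)"
        using mB L t' lr(1) by (intro add_mono mult_mono order_refl) auto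
      also have "\<dots> \<le> poly ?q B"
        by (simp add: poly_pcompose power2_eq_square algebra_simps)
      finally have "?T \<le> poly ?q B" .
      then show ?thesis using run dist setDs post(2)
        unfolding B_def M_def by (intro exI[of _ ?T] exI[of _ s'] exI[of _ Ds]) auto
    qed
  qed
  show ?thesis unfolding output_polynomial_def
  proof (intro exI[of _ ?prog] exI[of _ ?q] ballI)
    fix x assume x: "x \<in> instances Enum_Tr"
    obtain n es where xe: "x = (n, es)" by force
    have es: "\<And>e. e \<in> set es \<Longrightarrow> e \<subseteq> {..<n}" using x by (auto simp: xe Enum_Tr_def)
    let ?w = "ones n @ Sep # concat (map (bits n) es)"
    obtain T s ys where *: "runs ?prog (init_store ?w) T s" "distinct ys"
      "set ys = minimal_hitting_sets {..<n} (set es)" "s 1 = concat (map (bits n) ys)"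
      "T \<le> poly ?q (length ?w + card (minimal_hitting_sets {..<n} (set es)))"
      using main[OF es refl] by blast
    then obtain t where t: "t \<le> T" "exec ?prog (init_store ?w) t s" by (auto simp: runs_def)
    have x_simps: "encode Enum_Tr x = ?w" "solutions Enum_Tr x = minimal_hitting_sets {..<n} (set es)"
      "encode_sol Enum_Tr x = bits n"
      by (simp_all add: xe Enum_Tr_def)
    show "\<exists>t s ys. exec ?prog (init_store (encode Enum_Tr x)) t s \<and> distinct ys \<and>
        set ys = solutions Enum_Tr x \<and> s 1 = concat (map (encode_sol Enum_Tr x) ys) \<and>
        t \<le> poly ?q (length (encode Enum_Tr x) + card (solutions Enum_Tr x))"
      unfolding x_simps using t * order_trans[OF t(1) *(5)] by blast
  qed
qed

lemma image_nth: "(!) es ` {..<length es} = set es"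
  by (auto simp: set_conv_nth)

theorem theorem9:
  assumes "output_polynomial (Enum_CRDF split_graph) \<or> output_polynomial (Enum_TRDF split_graph)"
  shows "output_polynomial Enum_Tr"
  using assms
proof
  assume "output_polynomial (Enum_CRDF split_graph)"
  then show ?thesis
    by (rule output_polynomial_Enum_TrI)
       (simp_all add: Enum_CRDF_def red_set_def red_lab_def gadget.C_CRDF_eq image_nth)
next
  assume "output_polynomial (Enum_TRDF split_graph)"
  then show ?thesis
    by (rule output_polynomial_Enum_TrI)
       (simp_all add: Enum_TRDF_def red_set_def red_lab_def gadget.C_TRDF_eq image_nth)
qed

end
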